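(* There exist absolute constants $c>0$ and $d_0$ such that for all $d\ge d_0$, all $\kappa$ with $10\le \kappa\le d^4$, and every step size $h>0$, there is a twice-differentiable $f:\mathbb{R}^d\to\mathbb{R}$ with $I\preceq\nabla^2 f(x)\preceq\kappa I$ for all $x$, such that the relaxation time of the MALA Markov chain with step size $h$ targeting $\pi\propto e^{-f}$ is at least $c\,\kappa d/\log d$.
   Context: For $f:\mathbb{R}^d\to\mathbb{R}$ differentiable with $\int e^{-f}<\infty$, let $\pi$ denote the probability measure with density proportional to $e^{-f}$. The MALA Markov chain with step size $h>0$: from $x$, propose $y=x-h\nabla f(x)+\sqrt{2h}\,g$ with $g\sim\mathcal N(0,I_d)$; move to $y$ with probability $\min\{1,\exp(f(x)-f(y)+\frac{1}{4h}(\|y-x+h\nabla f(x)\|_2^2-\|x-y+h\nabla f(y)\|_2^2))\}$, otherwise stay at $x$. For a Markov kernel $\{\mathcal T_x\}$ reversible w.r.t. $\pi$, the Dirichlet form is $\mathcal E(\phi,\phi)=\frac12\iint(\phi(x)-\phi(y))^2\,\mathcal T_x(dy)\,\pi(dx)$, the spectral gap is $\lambda=\inf\{\mathcal E(\phi,\phi)/\mathrm{Var}_\pi(\phi)\}$ over non-constant $\phi\in L^2(\pi)$, and the relaxation time is $1/\lambda$. *)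

theory Defs
  imports "HOL-Probability.Probability"
begin

text \<open>Euclidean space R^d is represented by the extensional functions on the
index set {..<d}, i.e. the space of the product measure of d copies of
Lebesgue measure.\<close>

definition Leb :: "nat \<Rightarrow> (nat \<Rightarrow> real) measure" where
  "Leb d = PiM {..<d} (\<lambda>_. lborel)"

definition Rd :: "nat \<Rightarrow> (nat \<Rightarrow> real) set" where
  "Rd d = space (Leb d)"

definition Gauss :: "nat \<Rightarrow> (nat \<Rightarrow> real) measure" where
  "Gauss d = PiM {..<d} (\<lambda>_. density lborel std_normal_density)"

definition enorm :: "nat \<Rightarrow> (nat \<Rightarrow> real) \<Rightarrow> real" where
  "enorm d v = sqrt (\<Sum>i<d. (v i)\<^sup>2)"

definition has_gradient_on :: "nat \<Rightarrow> ((nat \<Rightarrow> real) \<Rightarrow> real) \<Rightarrow> ((nat \<Rightarrow> real) \<Rightarrow> nat \<Rightarrow> real) \<Rightarrow> bool" where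
  "has_gradient_on d f G \<longleftrightarrow> (\<forall>x\<in>Rd d. \<forall>e>0. \<exists>\<delta>>0. \<forall>y\<in>Rd d.
      enorm d (\<lambda>i. y i - x i) < \<delta> \<longrightarrow>
      \<bar>f y - f x - (\<Sum>i<d. G x i * (y i - x i))\<bar> \<le> e * enorm d (\<lambda>i. y i - x i))"

definition has_hessian_on :: "nat \<Rightarrow> ((nat \<Rightarrow> real) \<Rightarrow> nat \<Rightarrow> real) \<Rightarrow> ((nat \<Rightarrow> real) \<Rightarrow> nat \<Rightarrow> nat \<Rightarrow> real) \<Rightarrow> bool" where
  "has_hessian_on d G H \<longleftrightarrow> (\<forall>x\<in>Rd d. \<forall>e>0. \<exists>\<delta>>0. \<forall>y\<in>Rd d.
      enorm d (\<lambda>i. y i - x i) < \<delta> \<longrightarrow>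
      enorm d (\<lambda>i. G y i - G x i - (\<Sum>j<d. H x i j * (y j - x j))) \<le> e * enorm d (\<lambda>i. y i - x i))"

definition loewner_between :: "nat \<Rightarrow> real \<Rightarrow> (nat \<Rightarrow> nat \<Rightarrow> real) \<Rightarrow> real \<Rightarrow> bool" where
  "loewner_between d a M b \<longleftrightarrow> (\<forall>v. a * (\<Sum>i<d. (v i)\<^sup>2) \<le> (\<Sum>i<d. \<Sum>j<d. v i * M i j * v j)
      \<and> (\<Sum>i<d. \<Sum>j<d. v i * M i j * v j) \<le> b * (\<Sum>i<d. (v i)\<^sup>2))"

definition target :: "nat \<Rightarrow> ((nat \<Rightarrow> real) \<Rightarrow> real) \<Rightarrow> (nat \<Rightarrow> real) measure" where
  "target d f = density (Leb d)
     (\<lambda>x. ennreal (exp (- f x) / (\<integral>z. exp (- f z) \<partial>Leb d)))"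

definition mala_proposal :: "nat \<Rightarrow> ((nat \<Rightarrow> real) \<Rightarrow> nat \<Rightarrow> real) \<Rightarrow> real \<Rightarrow> (nat \<Rightarrow> real) \<Rightarrow> (nat \<Rightarrow> real) measure" where
  "mala_proposal d G h x = distr (Gauss d) (Leb d)
     (\<lambda>g. restrict (\<lambda>i. x i - h * G x i + sqrt (2 * h) * g i) {..<d})"

definition mala_accept :: "nat \<Rightarrow> ((nat \<Rightarrow> real) \<Rightarrow> real) \<Rightarrow> ((nat \<Rightarrow> real) \<Rightarrow> nat \<Rightarrow> real) \<Rightarrow> real
    \<Rightarrow> (nat \<Rightarrow> real) \<Rightarrow> (nat \<Rightarrow> real) \<Rightarrow> real" where
  "mala_accept d f G h x y = min 1 (exp (f x - f y + (1 / (4 * h)) *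
      ((enorm d (\<lambda>i. y i - x i + h * G x i))\<^sup>2 - (enorm d (\<lambda>i. x i - y i + h * G y i))\<^sup>2)))"

definition mala_kernel :: "nat \<Rightarrow> ((nat \<Rightarrow> real) \<Rightarrow> real) \<Rightarrow> ((nat \<Rightarrow> real) \<Rightarrow> nat \<Rightarrow> real) \<Rightarrow> real
    \<Rightarrow> (nat \<Rightarrow> real) \<Rightarrow> (nat \<Rightarrow> real) measure" where
  "mala_kernel d f G h x = mala_proposal d G h x \<bind> (\<lambda>y.
      distr (measure_pmf (bernoulli_pmf (mala_accept d f G h x y))) (Leb d)
            (\<lambda>b. if b then y else x))"

definition dirichlet_form :: "'a measure \<Rightarrow> ('a \<Rightarrow> 'a measure) \<Rightarrow> ('a \<Rightarrow> real) \<Rightarrow> ennreal" where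
  "dirichlet_form \<pi> T \<phi> = (1/2) * (\<integral>\<^sup>+x. (\<integral>\<^sup>+y. ennreal ((\<phi> x - \<phi> y)\<^sup>2) \<partial>T x) \<partial>\<pi>)"

definition var_meas :: "'a measure \<Rightarrow> ('a \<Rightarrow> real) \<Rightarrow> real" where
  "var_meas \<pi> \<phi> = (\<integral>x. (\<phi> x - (\<integral>z. \<phi> z \<partial>\<pi>))\<^sup>2 \<partial>\<pi>)"

definition nonconst_L2 :: "'a measure \<Rightarrow> ('a \<Rightarrow> real) set" where
  "nonconst_L2 \<pi> = {\<phi>. \<phi> \<in> borel_measurable \<pi> \<and> integrable \<pi> (\<lambda>x. (\<phi> x)\<^sup>2)
       \<and> \<not> (\<exists>c. AE x in \<pi>. \<phi> x = c)}"

definition spectral_gap :: "'a measure \<Rightarrow> ('a \<Rightarrow> 'a measure) \<Rightarrow> ennreal" where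
  "spectral_gap \<pi> T = (INF \<phi>\<in>nonconst_L2 \<pi>. dirichlet_form \<pi> T \<phi> / ennreal (var_meas \<pi> \<phi>))"

definition relaxation_time :: "'a measure \<Rightarrow> ('a \<Rightarrow> 'a measure) \<Rightarrow> ennreal" where
  "relaxation_time \<pi> T = 1 / spectral_gap \<pi> T"

end

theory Submission
  imports Defs "HOL-Real_Asymp.Real_Asymp"
begin

text \<open>The target may depend on \<^term>\<open>h\<close>. If \<^term>\<open>h\<close> is at most a constant times
  \<^term>\<open>ln d / (\<kappa> * d)\<close>, the standard Gaussian works: a coordinate moves by
  O(h) in mean square per step, so the spectral gap is at most \<^term>\<open>2 * h\<close>.

  For larger \<^term>\<open>h\<close> take the separable potential with one-dimensional profile
  \<^term>\<open>t\<^sup>2 / 2 + (\<kappa> - 1) * h * sqrt (1 + t\<^sup>2 / h)\<close>, whose curvature drops from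
  \<^term>\<open>\<kappa>\<close> to \<^term>\<open>1\<close> exactly at the scale \<^term>\<open>sqrt h\<close> of a proposal. From the
  minimum, every coordinate then contributes a nonpositive amount to the logarithm of the acceptance
  ratio, and with constant probability at most \<^term>\<open>- ((\<kappa> - 1) * h / 12)\<close>. Hence a proposal
  from the minimum is accepted with probability below \<^term>\<open>1 / d ^ 5\<close>. By continuity this persists
  on a small cube, and the indicator of that cube is a test function with tiny Dirichlet form; no
  lower bound on the mass of the cube is needed. As \<^term>\<open>\<kappa> * d \<le> d ^ 5\<close>, this suffices.\<close>

section \<open>Product densities and the proposal\<close>

text \<open>Boxes determine a product measure over a finite index set. On a box both the density and
  the indicator factorize, so Tonelli splits the integral into one factor per coordinate.\<close>

lemma PiM_density_lborel:
  fixes p :: "'i \<Rightarrow> real \<Rightarrow> real"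
  assumes I: "finite I" and p: "\<And>i. p i \<in> borel_measurable borel" "\<And>i t. 0 \<le> p i t"
    and prob: "\<And>i. prob_space (density lborel (p i))"
  shows "PiM I (\<lambda>i. density lborel (p i)) = density (PiM I (\<lambda>_. lborel)) (\<lambda>x. ennreal (\<Prod>i\<in>I. p i (x i)))"
proof -
  note p(1)[measurable]
  interpret product_sigma_finite "\<lambda>i. density lborel (p i)"
    using prob by (simp add: product_sigma_finite_def prob_space_imp_sigma_finite)
  interpret L: product_sigma_finite "\<lambda>_::'i. lborel :: real measure"
    by (simp add: product_sigma_finite_def sigma_finite_lborel)
  have "density (PiM I (\<lambda>_. lborel)) (\<lambda>x. ennreal (\<Prod>i\<in>I. p i (x i))) = PiM I (\<lambda>i. density lborel (p i))"
  proof (rule PiM_eqI[OF I])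
    show "sets (density (PiM I (\<lambda>_. lborel)) (\<lambda>x. ennreal (\<Prod>i\<in>I. p i (x i)))) = PiM I (\<lambda>i. density lborel (p i))"
      by (simp cong: sets_PiM_cong)
    fix A :: "'i \<Rightarrow> real set" assume "\<And>i. i \<in> I \<Longrightarrow> A i \<in> sets (density lborel (p i))"
    then have A[measurable]: "\<And>i. i \<in> I \<Longrightarrow> A i \<in> sets borel" by simp
    have m: "Pi\<^sub>E I A \<in> sets (PiM I (\<lambda>_. lborel))"
      using I A by (intro sets_PiM_I_finite) auto
    have "emeasure (density (PiM I (\<lambda>_. lborel)) (\<lambda>x. ennreal (\<Prod>i\<in>I. p i (x i)))) (Pi\<^sub>E I A)
        = (\<integral>\<^sup>+x. ennreal (\<Prod>i\<in>I. p i (x i)) * indicator (Pi\<^sub>E I A) x \<partial>PiM I (\<lambda>_. lborel))"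
      using m by (subst emeasure_density) auto
    also have "\<dots> = (\<integral>\<^sup>+x. (\<Prod>i\<in>I. ennreal (p i (x i)) * indicator (A i) (x i)) \<partial>PiM I (\<lambda>_. lborel))"
    proof (rule nn_integral_cong)
      fix x assume x: "x \<in> space (PiM I (\<lambda>_. lborel :: real measure))"
      have "indicator (Pi\<^sub>E I A) x = (\<Prod>i\<in>I. indicator (A i) (x i) :: ennreal)"
      proof (cases "\<forall>i\<in>I. x i \<in> A i")
        case True then show ?thesis using x by (auto simp: space_PiM PiE_def)
      next
        case False
        then have "x \<notin> Pi\<^sub>E I A" by auto
        moreover have "(\<Prod>i\<in>I. indicator (A i) (x i) :: ennreal) = 0"
          using False I by (intro prod_zero) (auto simp: indicator_def)
        ultimately show ?thesis by simp
      qed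
      then show "ennreal (\<Prod>i\<in>I. p i (x i)) * indicator (Pi\<^sub>E I A) x = (\<Prod>i\<in>I. ennreal (p i (x i)) * indicator (A i) (x i))"
        by (simp add: prod.distrib prod_ennreal p(2))
    qed
    also have "\<dots> = (\<Prod>i\<in>I. \<integral>\<^sup>+t. ennreal (p i t) * indicator (A i) t \<partial>lborel)"
      using I by (intro L.product_nn_integral_prod) auto
    also have "\<dots> = (\<Prod>i\<in>I. emeasure (density lborel (p i)) (A i))"
      by (intro prod.cong refl, subst emeasure_density) auto
    finally show "emeasure (density (PiM I (\<lambda>_. lborel)) (\<lambda>x. ennreal (\<Prod>i\<in>I. p i (x i)))) (Pi\<^sub>E I A)
        = (\<Prod>i\<in>I. emeasure (density lborel (p i)) (A i))" .
  qed
  then show ?thesis by simp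
qed

lemma measurable_Leb_component [measurable]: "i < d \<Longrightarrow> (\<lambda>x. x i) \<in> borel_measurable (Leb d)"
  unfolding Leb_def by measurable

lemma sigma_finite_Leb: "sigma_finite_measure (Leb d)"
proof -
  interpret product_sigma_finite "\<lambda>_::nat. lborel :: real measure"
    by (simp add: product_sigma_finite_def sigma_finite_lborel)
  show ?thesis unfolding Leb_def by (rule sigma_finite) simp
qed

lemma sets_Gauss: "sets (Gauss d) = sets (Leb d)"
  unfolding Leb_def Gauss_def by (rule sets_PiM_cong) auto

lemma measurable_Gauss: "measurable (Gauss d) N = measurable (Leb d) N"
  by (rule measurable_cong_sets[OF sets_Gauss refl])

lemma prob_space_Gauss: "prob_space (Gauss d)"
  unfolding Gauss_def by (intro prob_space_PiM prob_space_normal_density) simp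

text \<open>Substitution \<open>y = m + s * t\<close> in the Lebesgue integral; the Jacobian
  \<open>s\<close> turns the density with mean \<open>m\<close> and standard deviation
  \<open>s\<close> into the standard one.\<close>

lemma emeasure_normal_density_affine:
  assumes "0 < s" and [measurable]: "A \<in> sets borel"
  shows "emeasure (density lborel std_normal_density) {t. m + s * t \<in> A}
       = emeasure (density lborel (normal_density m s)) A"
proof -
  have *: "{t. m + s * t \<in> A} \<in> sets borel" by measurable
  have d: "s * normal_density m s (m + s * t) = std_normal_density t" for t
    using \<open>0 < s\<close> by (simp add: normal_density_def real_sqrt_mult power_mult_distrib divide_simps)
  have "emeasure (density lborel (normal_density m s)) A
      = (\<integral>\<^sup>+y. ennreal (normal_density m s y) * indicator A y \<partial>lborel)"
    by (subst emeasure_density) auto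
  also have "\<dots> = ennreal \<bar>s\<bar> * (\<integral>\<^sup>+t. ennreal (normal_density m s (m + s * t)) * indicator A (m + s * t) \<partial>lborel)"
    using \<open>0 < s\<close> by (intro nn_integral_real_affine) auto
  also have "\<dots> = (\<integral>\<^sup>+t. ennreal s * (ennreal (normal_density m s (m + s * t)) * indicator A (m + s * t)) \<partial>lborel)"
    using \<open>0 < s\<close> by (subst nn_integral_cmult) auto
  also have "\<dots> = (\<integral>\<^sup>+t. ennreal (std_normal_density t) * indicator {t. m + s * t \<in> A} t \<partial>lborel)"
    using \<open>0 < s\<close>
    by (intro nn_integral_cong) (simp add: d[symmetric] ennreal_mult mult.assoc indicator_def)
  also have "\<dots> = emeasure (density lborel std_normal_density) {t. m + s * t \<in> A}"
    using * by (subst emeasure_density) auto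
  finally show ?thesis ..
qed

text \<open>A coordinatewise affine map pulls boxes back to boxes, so it carries the product
  Gaussian to a product of one-dimensional normals. Having an explicit density allows reversibility
  to be checked pointwise.\<close>

lemma mala_proposal_eq_density:
  assumes h: "0 < h"
  shows "mala_proposal d G h x = density (Leb d)
    (\<lambda>y. ennreal (\<Prod>i<d. normal_density (x i - h * G x i) (sqrt (2 * h)) (y i)))"
proof -
  define s where "s = sqrt (2 * h)"
  define m where "m i = x i - h * G x i" for i
  have s: "0 < s" using h by (simp add: s_def)
  interpret product_sigma_finite "\<lambda>i::nat. density lborel (normal_density (m i) s)"
    using prob_space_normal_density[OF s]
    by (simp add: product_sigma_finite_def prob_space_imp_sigma_finite)
  interpret P: product_prob_space "\<lambda>i::nat. density lborel std_normal_density" "{..<d}"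
    by (simp add: product_prob_space_def product_sigma_finite_def product_prob_space_axioms_def
        prob_space_imp_sigma_finite prob_space_normal_density)
  have M[measurable]: "(\<lambda>g. restrict (\<lambda>i. m i + s * g i) {..<d}) \<in> measurable (Gauss d) (Leb d)"
    unfolding measurable_Gauss unfolding Leb_def by measurable
  have "distr (Gauss d) (Leb d) (\<lambda>g. restrict (\<lambda>i. m i + s * g i) {..<d})
      = PiM {..<d} (\<lambda>i. density lborel (normal_density (m i) s))"
  proof (rule PiM_eqI)
    show "sets (distr (Gauss d) (Leb d) (\<lambda>g. restrict (\<lambda>i. m i + s * g i) {..<d}))
        = PiM {..<d} (\<lambda>i. density lborel (normal_density (m i) s))"
      unfolding Leb_def by (simp cong: sets_PiM_cong)
    fix A assume "\<And>i. i \<in> {..<d} \<Longrightarrow> A i \<in> sets (density lborel (normal_density (m i) s))"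
    then have A[measurable]: "\<And>i. i < d \<Longrightarrow> A i \<in> sets borel" by simp
    have m: "Pi\<^sub>E {..<d} A \<in> sets (Leb d)"
      unfolding Leb_def using A by (intro sets_PiM_I_finite) auto
    have "(\<lambda>g. restrict (\<lambda>i. m i + s * g i) {..<d}) -` Pi\<^sub>E {..<d} A \<inter> space (Gauss d)
        = Pi\<^sub>E {..<d} (\<lambda>i. {t. m i + s * t \<in> A i})"
      by (auto simp: Gauss_def space_PiM PiE_def Pi_def)
    then have "emeasure (distr (Gauss d) (Leb d) (\<lambda>g. restrict (\<lambda>i. m i + s * g i) {..<d})) (Pi\<^sub>E {..<d} A)
        = emeasure (Gauss d) (Pi\<^sub>E {..<d} (\<lambda>i. {t. m i + s * t \<in> A i}))"
      using m by (subst emeasure_distr) auto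
    also have "\<dots> = (\<Prod>i<d. emeasure (density lborel std_normal_density) {t. m i + s * t \<in> A i})"
      unfolding Gauss_def by (intro P.emeasure_PiM) auto
    also have "\<dots> = (\<Prod>i<d. emeasure (density lborel (normal_density (m i) s)) (A i))"
      using s by (intro prod.cong refl emeasure_normal_density_affine) auto
    finally show "emeasure (distr (Gauss d) (Leb d) (\<lambda>g. restrict (\<lambda>i. m i + s * g i) {..<d})) (Pi\<^sub>E {..<d} A)
        = (\<Prod>i<d. emeasure (density lborel (normal_density (m i) s)) (A i))" .
  qed simp
  also have "\<dots> = density (Leb d) (\<lambda>y. ennreal (\<Prod>i<d. normal_density (m i) s (y i)))"
    unfolding Leb_def using s by (intro PiM_density_lborel prob_space_normal_density) auto
  finally show ?thesis
    by (simp add: mala_proposal_def m_def s_def)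
qed

section \<open>The Dirichlet form of the Metropolized kernel\<close>

lemma mala_accept_nonneg: "0 \<le> mala_accept d f G h x y"
  and mala_accept_le_1: "mala_accept d f G h x y \<le> 1"
  by (auto simp: mala_accept_def)

locale mala_measurable =
  fixes d :: nat and f :: "(nat \<Rightarrow> real) \<Rightarrow> real" and G :: "(nat \<Rightarrow> real) \<Rightarrow> nat \<Rightarrow> real" and h :: real
  assumes h_pos: "0 < h"
    and f_measurable [measurable]: "f \<in> borel_measurable (Leb d)"
    and G_measurable [measurable]: "\<And>i. i < d \<Longrightarrow> (\<lambda>x. G x i) \<in> borel_measurable (Leb d)"
begin

lemma measurable_accept [measurable]:
  "(\<lambda>(x, y). mala_accept d f G h x y) \<in> borel_measurable (Leb d \<Otimes>\<^sub>M Leb d)"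
  unfolding mala_accept_def enorm_def by measurable

lemma measurable_accept2 [measurable]:
  assumes [measurable]: "x \<in> space (Leb d)"
  shows "mala_accept d f G h x \<in> borel_measurable (Leb d)"
  by measurable

lemma sets_proposal: "sets (mala_proposal d G h x) = sets (Leb d)"
  by (simp add: mala_proposal_def)

text \<open>The two-atom formula shows that the law of the next state depends on \<open>y\<close>
  only through measurable functions, which gives the measurability required by the monadic bind in
  \<open>mala_kernel\<close>.\<close>

lemma emeasure_accept_reject:
  assumes "x \<in> space (Leb d)" "y \<in> space (Leb d)" "A \<in> sets (Leb d)"
  shows "emeasure (distr (measure_pmf (bernoulli_pmf (mala_accept d f G h x y))) (Leb d) (\<lambda>b. if b then y else x)) A
    = ennreal (mala_accept d f G h x y) * indicator A y + ennreal (1 - mala_accept d f G h x y) * indicator A x"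
proof -
  have "(\<lambda>b. if b then y else x) \<in> measurable (measure_pmf (bernoulli_pmf (mala_accept d f G h x y))) (Leb d)"
    using assms by auto
  then have "(\<integral>\<^sup>+z. indicator A z \<partial>distr (measure_pmf (bernoulli_pmf (mala_accept d f G h x y))) (Leb d) (\<lambda>b. if b then y else x))
    = (\<integral>\<^sup>+b. indicator A (if b then y else x) \<partial>measure_pmf (bernoulli_pmf (mala_accept d f G h x y)))"
    using assms by (intro nn_integral_distr) auto
  then show ?thesis
    using assms mala_accept_nonneg[of d f G h x y] mala_accept_le_1[of d f G h x y]
    by (simp add: mult.commute)
qed

lemma measurable_accept_reject:
  assumes x: "x \<in> space (Leb d)"
  shows "(\<lambda>y. distr (measure_pmf (bernoulli_pmf (mala_accept d f G h x y))) (Leb d) (\<lambda>b. if b then y else x))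
    \<in> measurable (Leb d) (subprob_algebra (Leb d))"
proof (rule measurable_subprob_algebra)
  fix y assume y: "y \<in> space (Leb d)"
  have "(\<lambda>b. if b then y else x) \<in> measurable (measure_pmf (bernoulli_pmf (mala_accept d f G h x y))) (Leb d)"
    using x y by auto
  then show "subprob_space (distr (measure_pmf (bernoulli_pmf (mala_accept d f G h x y))) (Leb d) (\<lambda>b. if b then y else x))"
    by (intro prob_space_imp_subprob_space prob_space.prob_space_distr measure_pmf.prob_space_axioms)
next
  fix A assume A[measurable]: "A \<in> sets (Leb d)"
  note x[measurable]
  have "(\<lambda>y. ennreal (mala_accept d f G h x y) * indicator A y + ennreal (1 - mala_accept d f G h x y) * indicator A x)
      \<in> borel_measurable (Leb d)"
    by measurable
  then show "(\<lambda>y. emeasure (distr (measure_pmf (bernoulli_pmf (mala_accept d f G h x y))) (Leb d) (\<lambda>b. if b then y else x)) A)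
      \<in> borel_measurable (Leb d)"
    by (rule measurable_cong[THEN iffD2, rotated]) (rule emeasure_accept_reject[OF x _ A])
qed simp

text \<open>The hypothesis \<open>\<phi> x = 0\<close> removes the rejection atom at
  \<open>x\<close>, so only accepted moves contribute. Squared increments of a test function,
  measured from \<open>x\<close>, have this property.\<close>

lemma nn_integral_kernel:
  assumes x: "x \<in> space (Leb d)" and [measurable]: "\<phi> \<in> borel_measurable (Leb d)" and "\<phi> x = 0"
  shows "(\<integral>\<^sup>+y. \<phi> y \<partial>mala_kernel d f G h x)
    = (\<integral>\<^sup>+y. ennreal (mala_accept d f G h x y) * \<phi> y \<partial>mala_proposal d G h x)"
proof -
  have "(\<integral>\<^sup>+y. \<phi> y \<partial>mala_kernel d f G h x) = (\<integral>\<^sup>+y. (\<integral>\<^sup>+z. \<phi> z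
      \<partial>distr (measure_pmf (bernoulli_pmf (mala_accept d f G h x y))) (Leb d) (\<lambda>b. if b then y else x))
      \<partial>mala_proposal d G h x)"
    unfolding mala_kernel_def
    by (rule nn_integral_bind[where B = "Leb d"])
       (use measurable_accept_reject[OF x] in \<open>auto simp: measurable_cong_sets[OF sets_proposal refl]\<close>)
  also have "\<dots> = (\<integral>\<^sup>+y. ennreal (mala_accept d f G h x y) * \<phi> y \<partial>mala_proposal d G h x)"
  proof (rule nn_integral_cong)
    fix y assume "y \<in> space (mala_proposal d G h x)"
    then have "y \<in> space (Leb d)" by (simp add: sets_eq_imp_space_eq[OF sets_proposal])
    then have "(\<lambda>b. if b then y else x) \<in> measurable (measure_pmf (bernoulli_pmf (mala_accept d f G h x y))) (Leb d)"
      using x by auto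
    then show "(\<integral>\<^sup>+z. \<phi> z \<partial>distr (measure_pmf (bernoulli_pmf (mala_accept d f G h x y))) (Leb d) (\<lambda>b. if b then y else x))
      = ennreal (mala_accept d f G h x y) * \<phi> y"
      using mala_accept_nonneg[of d f G h x y] mala_accept_le_1[of d f G h x y] \<open>\<phi> x = 0\<close>
      by (simp add: nn_integral_distr mult.commute)
  qed
  finally show ?thesis .
qed

text \<open>The transition density of the proposal with respect to Lebesgue measure;
  \<open>normal_density\<close> takes a standard deviation, hence \<open>sqrt (2 * h)\<close> for
  the variance \<open>2 * h\<close>.\<close>

definition q :: "(nat \<Rightarrow> real) \<Rightarrow> (nat \<Rightarrow> real) \<Rightarrow> real" where
  "q x y = (\<Prod>i<d. normal_density (x i - h * G x i) (sqrt (2 * h)) (y i))"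

lemma q_nonneg: "0 \<le> q x y"
  by (simp add: q_def prod_nonneg)

lemma proposal_eq: "mala_proposal d G h x = density (Leb d) (\<lambda>y. ennreal (q x y))"
  unfolding q_def by (rule mala_proposal_eq_density[OF h_pos])

lemma measurable_q [measurable]: "(\<lambda>(x, y). q x y) \<in> borel_measurable (Leb d \<Otimes>\<^sub>M Leb d)"
  unfolding q_def normal_density_def by measurable

lemma measurable_q2 [measurable]:
  assumes [measurable]: "x \<in> space (Leb d)"
  shows "q x \<in> borel_measurable (Leb d)"
  by measurable

text \<open>Exposes the squared norm that also occurs in \<open>mala_accept\<close>, so that the
  acceptance probability can be recognized as a Metropolis ratio.\<close>

lemma q_eq: "q x y = (1 / sqrt (4 * pi * h)) ^ d * exp (- (enorm d (\<lambda>i. y i - x i + h * G x i))\<^sup>2 / (4 * h))"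
proof -
  have "q x y = (\<Prod>i<d. 1 / sqrt (4 * pi * h) * exp (- (y i - x i + h * G x i)\<^sup>2 / (4 * h)))"
    unfolding q_def normal_density_def using h_pos
    by (intro prod.cong refl) (simp add: algebra_simps)
  also have "\<dots> = (1 / sqrt (4 * pi * h)) ^ d * exp (\<Sum>i<d. - (y i - x i + h * G x i)\<^sup>2 / (4 * h))"
    by (simp add: prod.distrib prod_dividef exp_sum power_divide)
  also have "(\<Sum>i<d. - (y i - x i + h * G x i)\<^sup>2 / (4 * h)) = - (enorm d (\<lambda>i. y i - x i + h * G x i))\<^sup>2 / (4 * h)"
    by (simp add: enorm_def sum_nonneg sum_negf sum_divide_distrib)
  finally show ?thesis .
qed

text \<open>Up to the common factor \<open>K\<close>, \<open>exp u\<close> and \<open>exp v\<close>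
  are target weight times proposal density in the two directions; both sides equal
  \<open>K * min (exp u) (exp v)\<close>.\<close>

lemma detailed_balance:
  "exp (- f x) * q x y * mala_accept d f G h x y = exp (- f y) * q y x * mala_accept d f G h y x"
proof -
  define K where "K = (1 / sqrt (4 * pi * h)) ^ d"
  define u where "u = - f x - (enorm d (\<lambda>i. y i - x i + h * G x i))\<^sup>2 / (4 * h)"
  define v where "v = - f y - (enorm d (\<lambda>i. x i - y i + h * G y i))\<^sup>2 / (4 * h)"
  have min: "exp a * min 1 (exp (b - a)) = min (exp a) (exp b)" for a b :: real
    by (simp add: min_def exp_diff)
  have "exp (- f x) * q x y = K * exp u" "exp (- f y) * q y x = K * exp v"
    by (simp_all add: q_eq K_def u_def v_def exp_diff exp_minus field_simps)
  moreover have "mala_accept d f G h x y = min 1 (exp (v - u))" "mala_accept d f G h y x = min 1 (exp (u - v))"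
    by (simp_all add: mala_accept_def u_def v_def algebra_simps diff_divide_distrib add_divide_distrib)
  ultimately show ?thesis
    using min[of u v] min[of v u] by (simp add: mult.assoc min.commute)
qed

definition accept_prob :: "(nat \<Rightarrow> real) \<Rightarrow> ennreal" where
  "accept_prob x = (\<integral>\<^sup>+y. ennreal (mala_accept d f G h x y) \<partial>mala_proposal d G h x)"

text \<open>By reversibility the flow into \<^term>\<open>S\<close> equals the flow out of it, and a move out of
  \<^term>\<open>S\<close> is in particular an accepted move.\<close>

lemma dirichlet_indicator_le:
  assumes S [measurable]: "S \<in> sets (Leb d)"
  shows "dirichlet_form (target d f) (mala_kernel d f G h) (indicator S)
    \<le> (\<integral>\<^sup>+x. accept_prob x * indicator S x \<partial>target d f)"
proof -
  interpret sigma_finite_measure "Leb d" by (rule sigma_finite_Leb)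
  interpret pair_sigma_finite "Leb d" "Leb d" ..
  define Z where "Z = (\<integral>z. exp (- f z) \<partial>Leb d)"
  \<comment> \<open>The density of the flow of accepted moves when the chain starts from the target;
    detailed balance makes it symmetric.\<close>
  define K where "K x y = ennreal (exp (- f x) / Z) * ennreal (q x y) * ennreal (mala_accept d f G h x y)" for x y
  \<comment> \<open>Integrability is not among the locale assumptions. If it fails, the Bochner
    integral \<open>Z\<close> is 0, and \<open>exp (- f x) / Z\<close> is then 0 as well.\<close>
  have Z: "0 \<le> Z" by (simp add: Z_def)
  have K_sym: "K x y = K y x" for x y
    using Z q_nonneg mala_accept_nonneg detailed_balance[of x y]
    by (simp add: K_def ennreal_mult[symmetric])
  have K_meas[measurable]: "(\<lambda>(x, y). K x y) \<in> borel_measurable (Leb d \<Otimes>\<^sub>M Leb d)"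
    unfolding K_def by measurable
  define J where "J x = (\<integral>\<^sup>+y. ennreal (q x y) * (ennreal (mala_accept d f G h x y)
      * ennreal ((indicator S x - indicator S y)\<^sup>2)) \<partial>Leb d)" for x
  have J_meas[measurable]: "J \<in> borel_measurable (Leb d)"
    unfolding J_def by measurable
  have J: "(\<integral>\<^sup>+y. ennreal ((indicator S x - indicator S y)\<^sup>2) \<partial>mala_kernel d f G h x) = J x"
    if x[measurable]: "x \<in> space (Leb d)" for x
  proof -
    have "(\<integral>\<^sup>+y. ennreal ((indicator S x - indicator S y)\<^sup>2) \<partial>mala_kernel d f G h x)
      = (\<integral>\<^sup>+y. ennreal (mala_accept d f G h x y) * ennreal ((indicator S x - indicator S y)\<^sup>2) \<partial>mala_proposal d G h x)"
      using x by (intro nn_integral_kernel) auto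
    also have "\<dots> = J x"
      unfolding proposal_eq J_def by (subst nn_integral_density) auto
    finally show ?thesis .
  qed
  \<comment> \<open>The squared difference of indicators is 1 exactly when \<open>x\<close> and
    \<open>y\<close> are separated by \<open>S\<close>. It splits the flow into
    \<open>L x y\<close>, which leaves \<open>S\<close>, and \<open>L y x\<close>, which by symmetry
    of \<open>K\<close> is the flow from \<open>x\<close> into \<open>S\<close>.\<close>
  define L where "L x y = K x y * indicator S x * indicator (- S) y" for x y
  have L_meas[measurable]: "(\<lambda>(x, y). L x y) \<in> borel_measurable (Leb d \<Otimes>\<^sub>M Leb d)"
    unfolding L_def by measurable
  define out where "out = (\<integral>\<^sup>+x. \<integral>\<^sup>+y. L x y \<partial>Leb d \<partial>Leb d)"
  have into: "(\<integral>\<^sup>+x. \<integral>\<^sup>+y. L y x \<partial>Leb d \<partial>Leb d) = out"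
    unfolding out_def by (rule Fubini'[symmetric]) measurable
  have "(\<integral>\<^sup>+x. (\<integral>\<^sup>+y. ennreal ((indicator S x - indicator S y)\<^sup>2) \<partial>mala_kernel d f G h x) \<partial>target d f)
      = (\<integral>\<^sup>+x. J x \<partial>target d f)"
    by (intro nn_integral_cong J) (simp add: target_def)
  also have "\<dots> = (\<integral>\<^sup>+x. ennreal (exp (- f x) / Z) * J x \<partial>Leb d)"
    unfolding target_def Z_def[symmetric] by (subst nn_integral_density) auto
  also have "\<dots> = (\<integral>\<^sup>+x. (\<integral>\<^sup>+y. L x y \<partial>Leb d) + (\<integral>\<^sup>+y. L y x \<partial>Leb d) \<partial>Leb d)"
  proof (rule nn_integral_cong)
    fix x assume x[measurable]: "x \<in> space (Leb d)"
    have "ennreal (exp (- f x) / Z) * J x = (\<integral>\<^sup>+y. ennreal (exp (- f x) / Z) *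
        (ennreal (q x y) * (ennreal (mala_accept d f G h x y) * ennreal ((indicator S x - indicator S y)\<^sup>2))) \<partial>Leb d)"
      unfolding J_def by (rule nn_integral_cmult[symmetric]) measurable
    also have "\<dots> = (\<integral>\<^sup>+y. L x y + L y x \<partial>Leb d)"
      unfolding L_def K_sym[of _ x]
      by (intro nn_integral_cong) (auto simp: K_def indicator_def mult.assoc)
    also have "\<dots> = (\<integral>\<^sup>+y. L x y \<partial>Leb d) + (\<integral>\<^sup>+y. L y x \<partial>Leb d)"
      by (rule nn_integral_add) measurable
    finally show "ennreal (exp (- f x) / Z) * J x = (\<integral>\<^sup>+y. L x y \<partial>Leb d) + (\<integral>\<^sup>+y. L y x \<partial>Leb d)" .
  qed
  also have "\<dots> = out + (\<integral>\<^sup>+x. \<integral>\<^sup>+y. L y x \<partial>Leb d \<partial>Leb d)"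
    unfolding out_def by (rule nn_integral_add) measurable
  also have "\<dots> = out + out" by (simp only: into)
  finally have "dirichlet_form (target d f) (mala_kernel d f G h) (indicator S) = (1 / 2) * (out + out)"
    by (simp add: dirichlet_form_def)
  also have "\<dots> = ((1 / 2) * 2) * out"
    by (simp add: mult_2 mult.assoc)
  also have "(1 / 2) * 2 = (1 :: ennreal)"
    by (simp add: ennreal_divide_times)
  \<comment> \<open>Forgetting that \<open>y\<close> must lie outside \<open>S\<close> bounds the
    outflow by all accepted moves from \<open>S\<close>.\<close>
  also have "1 * out \<le> (\<integral>\<^sup>+x. ennreal (exp (- f x) / Z) * (accept_prob x * indicator S x) \<partial>Leb d)"
    unfolding out_def mult_1
  proof (rule nn_integral_mono)
    fix x assume x[measurable]: "x \<in> space (Leb d)"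
    have "accept_prob x = (\<integral>\<^sup>+y. ennreal (q x y) * ennreal (mala_accept d f G h x y) \<partial>Leb d)"
      unfolding accept_prob_def proposal_eq by (subst nn_integral_density) auto
    then have "ennreal (exp (- f x) / Z) * accept_prob x = (\<integral>\<^sup>+y. K x y \<partial>Leb d)"
      unfolding K_def mult.assoc by (simp add: nn_integral_cmult)
    then have "ennreal (exp (- f x) / Z) * (accept_prob x * indicator S x)
      = (\<integral>\<^sup>+y. K x y * indicator S x \<partial>Leb d)"
      by (subst nn_integral_multc) (simp_all add: mult.assoc[symmetric])
    moreover have "(\<integral>\<^sup>+y. L x y \<partial>Leb d) \<le> (\<integral>\<^sup>+y. K x y * indicator S x \<partial>Leb d)"
      by (intro nn_integral_mono) (auto simp: L_def indicator_def)
    ultimately show "(\<integral>\<^sup>+y. L x y \<partial>Leb d) \<le> ennreal (exp (- f x) / Z) * (accept_prob x * indicator S x)"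
      by simp
  qed
  also have "\<dots> = (\<integral>\<^sup>+x. accept_prob x * indicator S x \<partial>target d f)"
  proof -
    have [measurable]: "accept_prob \<in> borel_measurable (Leb d)"
    proof (rule measurable_cong[THEN iffD2])
      fix x assume x[measurable]: "x \<in> space (Leb d)"
      show "accept_prob x = (\<integral>\<^sup>+y. ennreal (q x y) * ennreal (mala_accept d f G h x y) \<partial>Leb d)"
        unfolding accept_prob_def proposal_eq by (subst nn_integral_density) auto
    qed measurable
    show ?thesis
      unfolding target_def Z_def[symmetric] by (subst nn_integral_density) auto
  qed
  finally show ?thesis .
qed

end

section \<open>Separable potentials\<close>

lemma ennreal_divide_mono:
  assumes "x \<le> y" "z \<le> (w :: ennreal)"
  shows "x / w \<le> y / z"
proof -
  have "inverse w \<le> inverse z"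
  proof (cases "z = 0 \<or> w = top")
    case False
    then obtain r s where "z = ennreal r" "w = ennreal s" "0 < r" "0 \<le> s"
      using assms(2) by (cases z; cases w) (auto simp: top_unique)
    then show ?thesis using assms(2) by (auto simp: inverse_ennreal)
  qed auto
  then show ?thesis
    unfolding divide_ennreal_def using assms(1) by (intro mult_mono) auto
qed

lemma spectral_gap_le:
  assumes "\<phi> \<in> nonconst_L2 \<pi>" "dirichlet_form \<pi> T \<phi> \<le> ennreal D" "v \<le> var_meas \<pi> \<phi>" "0 < v" "0 \<le> D"
  shows "spectral_gap \<pi> T \<le> ennreal (D / v)"
proof -
  have "spectral_gap \<pi> T \<le> dirichlet_form \<pi> T \<phi> / ennreal (var_meas \<pi> \<phi>)"
    unfolding spectral_gap_def using assms(1) by (rule INF_lower)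
  also have "\<dots> \<le> ennreal D / ennreal v"
    using assms by (intro ennreal_divide_mono ennreal_leI) auto
  also have "\<dots> = ennreal (D / v)"
    using assms by (simp add: divide_ennreal)
  finally show ?thesis .
qed

text \<open>Monotonicity of division in \<open>ennreal\<close> also covers a vanishing gap, for
  which \<open>1 / 0\<close> is \<open>top\<close>.\<close>

lemma relaxation_time_ge:
  assumes "spectral_gap \<pi> T \<le> ennreal l" "0 < l"
  shows "ennreal (1 / l) \<le> relaxation_time \<pi> T"
proof -
  have "ennreal (1 / l) = 1 / ennreal l"
    using divide_ennreal[of 1 l] assms(2) by simp
  also have "\<dots> \<le> relaxation_time \<pi> T"
    unfolding relaxation_time_def using assms(1) by (intro ennreal_divide_mono) auto
  finally show ?thesis .
qed

section \<open>Gradient and Hessian of separable functions\<close>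

lemma enorm_nonneg [simp]: "0 \<le> enorm d v"
  by (simp add: enorm_def sum_nonneg)

lemma abs_le_enorm: "i < d \<Longrightarrow> \<bar>v i\<bar> \<le> enorm d v"
  unfolding enorm_def
  using member_le_sum[of i "{..<d}" "\<lambda>i. (v i)\<^sup>2"] by (intro real_le_rsqrt) auto

lemma enorm_mono_scaled:
  assumes "0 \<le> e" "\<And>i. i < d \<Longrightarrow> \<bar>u i\<bar> \<le> e * \<bar>v i\<bar>"
  shows "enorm d u \<le> e * enorm d v"
proof -
  have "(\<Sum>i<d. (u i)\<^sup>2) \<le> (\<Sum>i<d. e\<^sup>2 * (v i)\<^sup>2)"
  proof (rule sum_mono)
    fix i assume "i \<in> {..<d}"
    then have "\<bar>u i\<bar>\<^sup>2 \<le> (e * \<bar>v i\<bar>)\<^sup>2" using assms by (intro power_mono) auto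
    then show "(u i)\<^sup>2 \<le> e\<^sup>2 * (v i)\<^sup>2" by (simp add: power_mult_distrib)
  qed
  then have "sqrt (\<Sum>i<d. (u i)\<^sup>2) \<le> sqrt (e\<^sup>2 * (\<Sum>i<d. (v i)\<^sup>2))"
    by (simp add: sum_distrib_left)
  then show ?thesis using assms(1) by (simp add: enorm_def real_sqrt_mult)
qed

text \<open>Each coordinate has its own radius of linear approximation. The minimum of these
  finitely many radii serves all coordinates, because the Euclidean norm dominates every coordinate
  increment.\<close>

lemma uniform_coordinate_derivative:
  fixes F :: "real \<Rightarrow> real"
  assumes "\<And>t. (F has_real_derivative F' t) (at t)" "0 < (e::real)"
  obtains \<delta> where "0 < \<delta>"
    "\<And>y i. i < d \<Longrightarrow> enorm d (\<lambda>i. y i - x i) < \<delta> \<Longrightarrow> \<bar>F (y i) - F (x i) - F' (x i) * (y i - x i)\<bar> \<le> e * \<bar>y i - x i\<bar>"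
proof -
  have "\<exists>\<delta>>0. \<forall>s. \<bar>s - t\<bar> < \<delta> \<longrightarrow> \<bar>F s - F t - F' t * (s - t)\<bar> \<le> e * \<bar>s - t\<bar>" for t
    using assms(1)[of t, unfolded has_field_derivative_def has_derivative_at_alt] assms(2) by auto
  then obtain D where D: "\<And>t. 0 < D t"
    "\<And>t s. \<bar>s - t\<bar> < D t \<Longrightarrow> \<bar>F s - F t - F' t * (s - t)\<bar> \<le> e * \<bar>s - t\<bar>"
    by metis
  \<comment> \<open>Inserting 1 keeps the set nonempty when \<open>d = 0\<close>.\<close>
  define \<delta> where "\<delta> = Min (insert 1 ((\<lambda>i. D (x i)) ` {..<d}))"
  have "0 < \<delta>" using D(1) by (simp add: \<delta>_def)
  moreover have "\<bar>F (y i) - F (x i) - F' (x i) * (y i - x i)\<bar> \<le> e * \<bar>y i - x i\<bar>"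
    if "i < d" "enorm d (\<lambda>i. y i - x i) < \<delta>" for y i
  proof (rule D(2))
    have "\<delta> \<le> D (x i)" using that(1) by (auto simp: \<delta>_def intro!: Min_le)
    then show "\<bar>y i - x i\<bar> < D (x i)"
      using abs_le_enorm[OF that(1), of "\<lambda>i. y i - x i"] that(2) by linarith
  qed
  ultimately show ?thesis using that by blast
qed

lemma has_gradient_on_separable:
  fixes F :: "real \<Rightarrow> real"
  assumes "\<And>t. (F has_real_derivative F' t) (at t)"
  shows "has_gradient_on d (\<lambda>x. \<Sum>i<d. F (x i)) (\<lambda>x i. F' (x i))"
  unfolding has_gradient_on_def
proof (intro ballI allI impI)
  fix x and e :: real assume "0 < e"
  \<comment> \<open>The \<open>d\<close> coordinate errors add up, so each receives a share of the
    tolerance; the \<open>+ 1\<close> avoids division by zero when \<open>d = 0\<close>.\<close>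
  then have e: "0 < e / (real d + 1)" by simp
  obtain \<delta> where \<delta>: "0 < \<delta>" "\<And>y i. i < d \<Longrightarrow> enorm d (\<lambda>i. y i - x i) < \<delta>
      \<Longrightarrow> \<bar>F (y i) - F (x i) - F' (x i) * (y i - x i)\<bar> \<le> e / (real d + 1) * \<bar>y i - x i\<bar>"
    using uniform_coordinate_derivative[OF assms e] by blast
  have "\<bar>(\<Sum>i<d. F (y i)) - (\<Sum>i<d. F (x i)) - (\<Sum>i<d. F' (x i) * (y i - x i))\<bar> \<le> e * enorm d (\<lambda>i. y i - x i)"
    if "enorm d (\<lambda>i. y i - x i) < \<delta>" for y
  proof -
    have "\<bar>(\<Sum>i<d. F (y i)) - (\<Sum>i<d. F (x i)) - (\<Sum>i<d. F' (x i) * (y i - x i))\<bar>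
        \<le> (\<Sum>i<d. \<bar>F (y i) - F (x i) - F' (x i) * (y i - x i)\<bar>)"
      unfolding sum_subtractf[symmetric] by (rule sum_abs)
    also have "\<dots> \<le> (\<Sum>i<d. e / (real d + 1) * enorm d (\<lambda>i. y i - x i))"
    proof (rule sum_mono)
      fix i assume i: "i \<in> {..<d}"
      then have "\<bar>y i - x i\<bar> \<le> enorm d (\<lambda>i. y i - x i)"
        using abs_le_enorm[of i d "\<lambda>i. y i - x i"] by simp
      then show "\<bar>F (y i) - F (x i) - F' (x i) * (y i - x i)\<bar> \<le> e / (real d + 1) * enorm d (\<lambda>i. y i - x i)"
        using \<delta>(2)[of i y] i that e by (meson lessThan_iff mult_left_mono order.trans less_imp_le)
    qed
    also have "\<dots> = (real d / (real d + 1)) * (e * enorm d (\<lambda>i. y i - x i))" by simp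
    also have "\<dots> \<le> 1 * (e * enorm d (\<lambda>i. y i - x i))"
      using \<open>0 < e\<close> by (intro mult_right_mono) auto
    finally show ?thesis by simp
  qed
  then show "\<exists>\<delta>>0. \<forall>y\<in>Rd d. enorm d (\<lambda>i. y i - x i) < \<delta> \<longrightarrow>
      \<bar>(\<Sum>i<d. F (y i)) - (\<Sum>i<d. F (x i)) - (\<Sum>i<d. F' (x i) * (y i - x i))\<bar> \<le> e * enorm d (\<lambda>i. y i - x i)"
    using \<delta>(1) by blast
qed

lemma sum_diagonal:
  fixes c :: "nat \<Rightarrow> real"
  assumes "i < d"
  shows "(\<Sum>j<d. (if i = j then c i else 0) * w j) = c i * w i"
  using assms by (subst sum.remove[of _ i]) (auto intro!: sum.neutral)

text \<open>With a diagonal matrix the remainder vector decouples, so a relative error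
  \<open>e\<close> in every coordinate gives the same relative error in norm.\<close>

lemma has_hessian_on_separable:
  fixes F' :: "real \<Rightarrow> real"
  assumes "\<And>t. (F' has_real_derivative F'' t) (at t)"
  shows "has_hessian_on d (\<lambda>x i. F' (x i)) (\<lambda>x i j. if i = j then F'' (x i) else 0)"
  unfolding has_hessian_on_def
proof (intro ballI allI impI)
  fix x and e :: real assume e: "0 < e"
  obtain \<delta> where \<delta>: "0 < \<delta>" "\<And>y i. i < d \<Longrightarrow> enorm d (\<lambda>i. y i - x i) < \<delta>
      \<Longrightarrow> \<bar>F' (y i) - F' (x i) - F'' (x i) * (y i - x i)\<bar> \<le> e * \<bar>y i - x i\<bar>"
    using uniform_coordinate_derivative[OF assms e] by blast
  have "enorm d (\<lambda>i. F' (y i) - F' (x i) - (\<Sum>j<d. (if i = j then F'' (x i) else 0) * (y j - x j)))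
      \<le> e * enorm d (\<lambda>i. y i - x i)" if "enorm d (\<lambda>i. y i - x i) < \<delta>" for y
    using e \<delta>(2)[of _ y] that sum_diagonal[of _ d "\<lambda>i. F'' (x i)" "\<lambda>j. y j - x j"]
    by (intro enorm_mono_scaled) auto
  then show "\<exists>\<delta>>0. \<forall>y\<in>Rd d. enorm d (\<lambda>i. y i - x i) < \<delta> \<longrightarrow>
      enorm d (\<lambda>i. F' (y i) - F' (x i) - (\<Sum>j<d. (if i = j then F'' (x i) else 0) * (y j - x j)))
      \<le> e * enorm d (\<lambda>i. y i - x i)"
    using \<delta>(1) by blast
qed

lemma loewner_between_diagonal:
  assumes "\<And>i. i < d \<Longrightarrow> a \<le> c i" "\<And>i. i < d \<Longrightarrow> c i \<le> b"
  shows "loewner_between d a (\<lambda>i j. if i = j then c i else 0) b"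
proof -
  have "(\<Sum>i<d. \<Sum>j<d. v i * (if i = j then c i else 0) * v j) = (\<Sum>i<d. c i * (v i)\<^sup>2)" for v
  proof (rule sum.cong[OF refl])
    fix i assume "i \<in> {..<d}"
    then show "(\<Sum>j<d. v i * (if i = j then c i else 0) * v j) = c i * (v i)\<^sup>2"
      using sum_diagonal[of i d c v]
      by (simp add: mult.assoc sum_distrib_left[symmetric] power2_eq_square)
  qed
  then show ?thesis
    using assms by (auto simp: loewner_between_def sum_distrib_left intro!: sum_mono mult_right_mono)
qed

text \<open>The Gaussian potential plus a pseudo-Huber term, which smooths
  \<open>a * sqrt h * |t|\<close> on the scale \<open>sqrt h\<close>. The choice
  \<open>a = 0\<close> gives the standard Gaussian, and \<open>a = \<kappa> - 1\<close> gives the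
  hard target.\<close>

definition pot :: "real \<Rightarrow> real \<Rightarrow> real \<Rightarrow> real" where
  "pot a h t = t\<^sup>2 / 2 + a * h * sqrt (1 + t\<^sup>2 / h)"

definition pot' :: "real \<Rightarrow> real \<Rightarrow> real \<Rightarrow> real" where
  "pot' a h t = t + a * t / sqrt (1 + t\<^sup>2 / h)"

definition pot'' :: "real \<Rightarrow> real \<Rightarrow> real \<Rightarrow> real" where
  "pot'' a h t = 1 + a / sqrt (1 + t\<^sup>2 / h) ^ 3"

locale hard_potential =
  fixes d :: nat and a h :: real
  assumes a_nonneg: "0 \<le> a" and h_pos: "0 < h"
begin

lemma radicand: "1 \<le> 1 + t\<^sup>2 / h"
  using h_pos by simp

lemma radicand_pos: "0 < 1 + t\<^sup>2 / h"
  using radicand[of t] by linarith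

lemma pot_has_derivative: "(pot a h has_real_derivative pot' a h t) (at t)"
  unfolding pot_def[abs_def] pot'_def using h_pos radicand_pos[of t]
  by (auto intro!: derivative_eq_intros simp: field_simps)

lemma pot'_has_derivative: "(pot' a h has_real_derivative pot'' a h t) (at t)"
proof -
  define u where "u t = sqrt (1 + t\<^sup>2 / h)" for t
  have u: "0 < u t" "(u t)\<^sup>2 = 1 + t\<^sup>2 / h" using radicand_pos[of t] by (auto simp: u_def)
  have u': "(u has_real_derivative t / h / u t) (at t)"
    unfolding u_def[abs_def] using h_pos radicand_pos[of t]
    by (auto intro!: derivative_eq_intros simp: field_simps)
  \<comment> \<open>Since \<open>t * t / h\<close> is the square of \<open>u t\<close> minus 1, the
    numerator of the quotient rule collapses to \<open>a / u t\<close>.\<close>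
  have eq: "(a * u t - a * t * (t / h / u t)) / (u t * u t) = a / u t ^ 3"
  proof -
    have "t * (t / h / u t) = ((u t)\<^sup>2 - 1) / u t"
      unfolding u(2) by (simp add: power2_eq_square)
    then have "a * t * (t / h / u t) = a * (((u t)\<^sup>2 - 1) / u t)"
      by (simp only: mult.assoc)
    then show ?thesis
      using u(1) by (simp only:) (simp add: field_simps power2_eq_square power3_eq_cube)
  qed
  have "((\<lambda>t. a * t) has_real_derivative a) (at t)"
    by (auto intro!: derivative_eq_intros)
  from DERIV_add[OF DERIV_ident DERIV_divide[OF this u']]
  have "((\<lambda>t. t + a * t / u t) has_real_derivative 1 + (a * u t - a * t * (t / h / u t)) / (u t * u t)) (at t)"
    using u(1) by simp
  then show ?thesis
    unfolding eq unfolding pot'_def[abs_def] pot''_def u_def .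
qed

lemma pot''_ge: "1 \<le> pot'' a h t"
  using a_nonneg radicand_pos[of t] by (simp add: pot''_def)

lemma pot''_le: "pot'' a h t \<le> 1 + a"
proof -
  have "1 ^ 3 \<le> sqrt (1 + t\<^sup>2 / h) ^ 3"
    using radicand[of t] by (intro power_mono) auto
  then have "a / sqrt (1 + t\<^sup>2 / h) ^ 3 \<le> a / 1"
    using a_nonneg radicand_pos[of t] by (intro divide_left_mono) auto
  then show ?thesis by (simp add: pot''_def)
qed

lemma pot_ge: "t\<^sup>2 / 2 \<le> pot a h t"
  using a_nonneg h_pos radicand_pos[of t] by (simp add: pot_def)

lemma pot_nonneg: "0 \<le> pot a h t"
  using pot_ge[of t] by (smt (verit) zero_le_power2 divide_nonneg_pos)

lemma measurable_pot [measurable]: "pot a h \<in> borel_measurable borel"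
  unfolding pot_def[abs_def] by measurable

lemma measurable_pot' [measurable]: "pot' a h \<in> borel_measurable borel"
  unfolding pot'_def[abs_def] by measurable

lemma continuous_pot [continuous_intros]: "continuous_on UNIV (pot a h)"
  using pot_has_derivative by (auto intro!: continuous_at_imp_continuous_on DERIV_isCont)

lemma continuous_pot' [continuous_intros]: "continuous_on UNIV (pot' a h)"
  using pot'_has_derivative by (auto intro!: continuous_at_imp_continuous_on DERIV_isCont)

definition f :: "(nat \<Rightarrow> real) \<Rightarrow> real" where "f x = (\<Sum>i<d. pot a h (x i))"
definition G :: "(nat \<Rightarrow> real) \<Rightarrow> nat \<Rightarrow> real" where "G x i = pot' a h (x i)"
definition H :: "(nat \<Rightarrow> real) \<Rightarrow> nat \<Rightarrow> nat \<Rightarrow> real" where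
  "H x i j = (if i = j then pot'' a h (x i) else 0)"

sublocale mala_measurable d f G h
  by unfold_locales (auto simp: h_pos f_def[abs_def] G_def)

lemma gradient: "has_gradient_on d f G"
  unfolding f_def[abs_def] G_def[abs_def]
  by (rule has_gradient_on_separable) (rule pot_has_derivative)

lemma hessian: "has_hessian_on d G H"
  unfolding G_def[abs_def] H_def[abs_def]
  by (rule has_hessian_on_separable) (rule pot'_has_derivative)

lemma hessian_bounds: "1 + a \<le> b \<Longrightarrow> loewner_between d 1 (H x) b"
  unfolding H_def[abs_def] using pot''_ge pot''_le
  by (intro loewner_between_diagonal) (auto intro: order.trans)

text \<open>The pseudo-Huber term is nonnegative, so the weight is dominated by the unnormalized
  Gaussian.\<close>

lemma integrable_exp_pot: "integrable lborel (\<lambda>t. exp (- pot a h t))"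
proof (rule Bochner_Integration.integrable_bound)
  show "integrable lborel (\<lambda>t. sqrt (2 * pi) * std_normal_density t)" by simp
  show "AE t in lborel. norm (exp (- pot a h t)) \<le> norm (sqrt (2 * pi) * std_normal_density t)"
    using pot_ge by (intro AE_I2) (simp add: std_normal_density_def abs_mult)
qed simp

lemma integral_exp_pot_pos: "0 < (\<integral>t. exp (- pot a h t) \<partial>lborel)"
proof -
  have "(\<integral>t. exp (- pot a h t) \<partial>lborel) \<noteq> 0"
  proof
    assume "(\<integral>t. exp (- pot a h t) \<partial>lborel) = 0"
    then have "AE t in (lborel :: real measure). False"
      using integral_nonneg_eq_0_iff_AE[OF integrable_exp_pot] by simp
    then show False by (simp add: eventually_False ae_filter_eq_bot_iff)
  qed
  then show ?thesis
    by (simp add: order_less_le integral_nonneg)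
qed

lemma exp_f: "exp (- f x) = (\<Prod>i<d. exp (- pot a h (x i)))"
  by (simp add: f_def exp_sum sum_negf[symmetric])

definition Z :: real where "Z = (\<integral>x. exp (- f x) \<partial>Leb d)"

lemma integrable_exp_f: "integrable (Leb d) (\<lambda>x. exp (- f x))"
  and Z_eq: "Z = (\<integral>t. exp (- pot a h t) \<partial>lborel) ^ d"
proof -
  interpret product_sigma_finite "\<lambda>_::nat. lborel :: real measure"
    by (simp add: product_sigma_finite_def sigma_finite_lborel)
  show "integrable (Leb d) (\<lambda>x. exp (- f x))"
    unfolding exp_f Leb_def by (intro product_integrable_prod integrable_exp_pot) simp
  show "Z = (\<integral>t. exp (- pot a h t) \<partial>lborel) ^ d"
    unfolding Z_def exp_f Leb_def by (subst product_integral_prod) (simp_all add: integrable_exp_pot)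
qed

lemma Z_pos: "0 < Z"
  unfolding Z_eq using integral_exp_pot_pos by simp

lemma target_eq: "target d f = density (Leb d) (\<lambda>x. ennreal (exp (- f x) / Z))"
  by (simp add: target_def Z_def)

lemma prob_space_target: "prob_space (target d f)"
proof (rule prob_spaceI)
  have "emeasure (target d f) (space (target d f)) = (\<integral>\<^sup>+x. ennreal (exp (- f x) / Z) \<partial>Leb d)"
    unfolding target_eq by (subst emeasure_density) (auto intro!: nn_integral_cong)
  also have "\<dots> = ennreal (\<integral>x. exp (- f x) / Z \<partial>Leb d)"
    using Z_pos integrable_exp_f by (intro nn_integral_eq_integral) auto
  also have "\<dots> = 1"
    using Z_pos by (simp add: Z_def[symmetric])
  finally show "emeasure (target d f) (space (target d f)) = 1" .
qed

end

section \<open>Small step sizes: the Gaussian target\<close>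

lemma prob_space_N01: "prob_space std_normal_distribution"
  by (rule prob_space_normal_density) simp

lemma integrable_N01_power [simp]: "integrable std_normal_distribution (\<lambda>t. t ^ k)"
  using integrable_std_normal_moment[of k] by (simp add: integrable_density)

lemma integrable_N01_id [simp]: "integrable std_normal_distribution (\<lambda>t. t)"
  using integrable_N01_power[of 1] by simp

lemma integral_N01_id: "(\<integral>t. t \<partial>std_normal_distribution) = 0"
  using integral_std_normal_moment_odd[of 0] by (simp add: integral_density)

lemma integral_N01_square: "(\<integral>t. t\<^sup>2 \<partial>std_normal_distribution) = 1"
  using integral_std_normal_moment_even[of 1] by (simp add: integral_density)

lemma nn_integral_N01_affine_square: "(\<integral>\<^sup>+t. ennreal ((c - s * t)\<^sup>2) \<partial>std_normal_distribution) = ennreal (c\<^sup>2 + s\<^sup>2)"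
proof -
  interpret prob_space std_normal_distribution by (rule prob_space_N01)
  have eq: "(c - s * t)\<^sup>2 = c\<^sup>2 - 2 * c * s * t + s\<^sup>2 * t\<^sup>2" for t
    by (simp add: power2_diff power_mult_distrib algebra_simps)
  have "integrable std_normal_distribution (\<lambda>t. (c - s * t)\<^sup>2)"
    unfolding eq by simp
  then have "(\<integral>\<^sup>+t. ennreal ((c - s * t)\<^sup>2) \<partial>std_normal_distribution) = ennreal (\<integral>t. (c - s * t)\<^sup>2 \<partial>std_normal_distribution)"
    by (intro nn_integral_eq_integral) auto
  also have "(\<integral>t. (c - s * t)\<^sup>2 \<partial>std_normal_distribution) = c\<^sup>2 + s\<^sup>2"
    unfolding eq using prob_space by (simp add: integral_N01_id integral_N01_square)
  finally show ?thesis .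
qed

lemma distr_Gauss_component: "i < d \<Longrightarrow> distr (Gauss d) std_normal_distribution (\<lambda>x. x i) = std_normal_distribution"
  unfolding Gauss_def by (rule distr_PiM_component) (auto intro: prob_space_N01)

lemma measurable_Gauss_component: "i < d \<Longrightarrow> (\<lambda>x. x i) \<in> measurable (Gauss d) std_normal_distribution"
  unfolding Gauss_def by (rule measurable_component_singleton) simp

lemma nn_integral_Gauss_component:
  assumes "i < d" and [measurable]: "g \<in> borel_measurable borel"
  shows "(\<integral>\<^sup>+x. g (x i) \<partial>Gauss d) = (\<integral>\<^sup>+t. g t \<partial>std_normal_distribution)"
  using nn_integral_distr[OF measurable_Gauss_component[OF assms(1)], of g]
  by (simp add: distr_Gauss_component assms(1))

lemma
  fixes g :: "real \<Rightarrow> real"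
  assumes "i < d" and [measurable]: "g \<in> borel_measurable borel"
  shows integral_Gauss_component: "(\<integral>x. g (x i) \<partial>Gauss d) = (\<integral>t. g t \<partial>std_normal_distribution)"
    and integrable_Gauss_component: "integrable std_normal_distribution g \<Longrightarrow> integrable (Gauss d) (\<lambda>x. g (x i))"
  using integral_distr[OF measurable_Gauss_component[OF assms(1)], of g]
    integrable_distr_eq[OF measurable_Gauss_component[OF assms(1)], of g]
  by (simp_all add: distr_Gauss_component assms(1))

text \<open>An almost everywhere constant function has variance 0, so positive variance excludes
  it.\<close>

lemma nonconst_L2I:
  assumes "prob_space \<pi>" "\<phi> \<in> borel_measurable \<pi>" "integrable \<pi> (\<lambda>x. (\<phi> x)\<^sup>2)" "0 < var_meas \<pi> \<phi>"
  shows "\<phi> \<in> nonconst_L2 \<pi>"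
proof -
  interpret prob_space \<pi> by fact
  have False if c: "AE x in \<pi>. \<phi> x = c" for c
  proof -
    have "(\<integral>z. \<phi> z \<partial>\<pi>) = (\<integral>z. c \<partial>\<pi>)"
      using c assms(2) by (intro integral_cong_AE) auto
    then have "(\<integral>z. \<phi> z \<partial>\<pi>) = c" using prob_space by simp
    then have "var_meas \<pi> \<phi> = (\<integral>z. 0 \<partial>\<pi>)"
      unfolding var_meas_def using c assms(2) by (intro integral_cong_AE) auto
    then show False using assms(4) by simp
  qed
  then show ?thesis using assms by (auto simp: nonconst_L2_def)
qed

context hard_potential begin

text \<open>For \<open>a = 0\<close> the weight is \<open>sqrt (2 * pi)\<close> times the normal
  density in each coordinate, and these factors cancel against \<open>Z\<close>.\<close>

lemma target_Gauss:
  assumes "a = 0"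
  shows "target d f = Gauss d"
proof -
  have e: "exp (- pot a h t) = sqrt (2 * pi) * std_normal_density t" for t
    using assms by (simp add: pot_def std_normal_density_def)
  have "exp (- f x) / Z = (\<Prod>i<d. std_normal_density (x i))" for x
    unfolding exp_f Z_eq e by (simp add: prod.distrib)
  moreover have "Gauss d = density (Leb d) (\<lambda>x. ennreal (\<Prod>i<d. std_normal_density (x i)))"
    unfolding Gauss_def Leb_def by (rule PiM_density_lborel) (auto intro: prob_space_N01)
  ultimately show ?thesis by (simp add: target_eq)
qed

text \<open>The test function is coordinate 0, of variance 1. A proposal moves it by
  \<open>- h * x 0 + sqrt (2 * h) * g 0\<close>; averaging the square over noise and target gives
  the square of \<open>h\<close> plus \<open>2 * h\<close>, and the Dirichlet form carries a factor
  1/2.\<close>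

lemma spectral_gap_Gauss_le:
  assumes "a = 0" "0 < d"
  shows "spectral_gap (target d f) (mala_kernel d f G h) \<le> ennreal (h + h\<^sup>2 / 2)"
proof -
  define \<phi> :: "(nat \<Rightarrow> real) \<Rightarrow> real" where "\<phi> x = x 0" for x
  note T = target_Gauss[OF assms(1)]
  have \<phi>_meas[measurable]: "\<phi> \<in> borel_measurable (Leb d)"
    unfolding \<phi>_def[abs_def] using assms(2) by measurable
  have "var_meas (Gauss d) \<phi> = 1"
    unfolding var_meas_def \<phi>_def using assms(2)
    by (simp add: integral_Gauss_component[where g = "\<lambda>t. t"] integral_N01_id
        integral_Gauss_component[where g = "\<lambda>t. t\<^sup>2"] integral_N01_square)
  then have var: "var_meas (target d f) \<phi> = 1" by (simp add: T)
  have L2: "\<phi> \<in> nonconst_L2 (target d f)"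
    unfolding T using var assms(2)
    by (intro nonconst_L2I prob_space_Gauss)
       (auto simp: measurable_Gauss T \<phi>_def intro!: integrable_Gauss_component[where g = "\<lambda>t. t\<^sup>2"])
  have inner: "(\<integral>\<^sup>+y. ennreal ((\<phi> x - \<phi> y)\<^sup>2) \<partial>mala_kernel d f G h x) \<le> ennreal ((h * x 0)\<^sup>2 + 2 * h)"
    if x: "x \<in> space (Leb d)" for x
  proof -
    have M[measurable]: "(\<lambda>g. \<lambda>i\<in>{..<d}. x i - h * G x i + sqrt (2 * h) * g i) \<in> measurable (Gauss d) (Leb d)"
      unfolding measurable_Gauss unfolding Leb_def by measurable
    have \<phi>_sq: "(\<lambda>y. ennreal ((\<phi> x - \<phi> y)\<^sup>2)) \<in> borel_measurable (Leb d)" by measurable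
    have G0: "G x 0 = x 0" unfolding G_def pot'_def using assms(1) by simp
    have "(\<integral>\<^sup>+y. ennreal ((\<phi> x - \<phi> y)\<^sup>2) \<partial>mala_kernel d f G h x)
        = (\<integral>\<^sup>+y. ennreal (mala_accept d f G h x y) * ennreal ((\<phi> x - \<phi> y)\<^sup>2) \<partial>mala_proposal d G h x)"
      using x by (intro nn_integral_kernel) auto
    \<comment> \<open>Rejections only shorten the displacement, so the acceptance factor is bounded
      by 1.\<close>
    also have "\<dots> \<le> (\<integral>\<^sup>+y. ennreal ((\<phi> x - \<phi> y)\<^sup>2) \<partial>mala_proposal d G h x)"
      using mala_accept_nonneg mala_accept_le_1
      by (intro nn_integral_mono) (simp add: ennreal_mult[symmetric] mult_left_le_one_le)
    also have "\<dots> = (\<integral>\<^sup>+g. ennreal ((h * x 0 - sqrt (2 * h) * g 0)\<^sup>2) \<partial>Gauss d)"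
      unfolding mala_proposal_def using \<phi>_sq assms(2)
      by (subst nn_integral_distr[OF M]) (simp_all add: \<phi>_def G0)
    also have "\<dots> = ennreal ((h * x 0)\<^sup>2 + 2 * h)"
      using assms(2) h_pos
      by (subst nn_integral_Gauss_component[where g = "\<lambda>t. ennreal ((h * x 0 - sqrt (2 * h) * t)\<^sup>2)"])
         (simp_all add: nn_integral_N01_affine_square)
    finally show ?thesis .
  qed
  have "(\<integral>\<^sup>+x. (\<integral>\<^sup>+y. ennreal ((\<phi> x - \<phi> y)\<^sup>2) \<partial>mala_kernel d f G h x) \<partial>target d f)
      \<le> (\<integral>\<^sup>+x. ennreal ((h * x 0)\<^sup>2 + 2 * h) \<partial>Gauss d)"
    unfolding T by (intro nn_integral_mono inner) (simp add: sets_eq_imp_space_eq[OF sets_Gauss])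
  also have "\<dots> = (\<integral>\<^sup>+t. ennreal ((0 - h * t)\<^sup>2) + ennreal (2 * h) \<partial>std_normal_distribution)"
    using assms(2) h_pos
    by (subst nn_integral_Gauss_component[where g = "\<lambda>t. ennreal ((h * t)\<^sup>2 + 2 * h)"]) auto
  also have "\<dots> = ennreal (0\<^sup>2 + h\<^sup>2) + ennreal (2 * h)"
    by (subst nn_integral_add) (auto simp del: diff_0
        simp: nn_integral_N01_affine_square prob_space.emeasure_space_1[OF prob_space_N01, simplified])
  also have "\<dots> = ennreal (h\<^sup>2 + 2 * h)"
    using h_pos by (simp add: ennreal_plus)
  finally have "dirichlet_form (target d f) (mala_kernel d f G h) \<phi> \<le> (1 / 2) * ennreal (h\<^sup>2 + 2 * h)"
    unfolding dirichlet_form_def by (intro mult_left_mono) auto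
  also have "(1 / 2) * ennreal (h\<^sup>2 + 2 * h) = ennreal (1 / 2) * ennreal (h\<^sup>2 + 2 * h)"
    using divide_ennreal[of 1 2] by simp
  also have "\<dots> = ennreal (h + h\<^sup>2 / 2)"
    using h_pos by (subst ennreal_mult[symmetric]) (auto simp: field_simps)
  finally have "dirichlet_form (target d f) (mala_kernel d f G h) \<phi> \<le> ennreal (h + h\<^sup>2 / 2)" .
  from spectral_gap_le[OF L2 this, of 1] show ?thesis
    using var h_pos by simp
qed

end

section \<open>Large step sizes: rejection near the minimum\<close>

text \<open>The absolute constant behind \<open>c\<close>: the probability that a proposal from the
  minimum moves a given coordinate by at least \<open>sqrt (2 * h)\<close>.\<close>

definition gauss_tail :: real where "gauss_tail = measure std_normal_distribution {t. 1 \<le> \<bar>t\<bar>}"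

lemma gauss_tail_pos: "0 < gauss_tail"
proof -
  interpret prob_space std_normal_distribution by (rule prob_space_N01)
  have "std_normal_density 2 \<le> std_normal_density t" if "t \<in> {1..2}" for t
  proof -
    have "t\<^sup>2 \<le> 2\<^sup>2" using that by (intro power_mono) auto
    then show ?thesis by (simp add: std_normal_density_def divide_right_mono)
  qed
  then have "(\<integral>\<^sup>+t. ennreal (std_normal_density 2) * indicator {1..2::real} t \<partial>lborel)
      \<le> (\<integral>\<^sup>+t. ennreal (std_normal_density t) * indicator {t. 1 \<le> \<bar>t\<bar>} t \<partial>lborel)"
    by (intro nn_integral_mono) (auto simp: indicator_def intro!: ennreal_leI)
  also have "\<dots> = emeasure std_normal_distribution {t. 1 \<le> \<bar>t\<bar>}"
    by (subst emeasure_density) auto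
  also have "\<dots> = ennreal gauss_tail" by (simp add: gauss_tail_def emeasure_eq_measure)
  finally have "ennreal (std_normal_density 2) \<le> ennreal gauss_tail"
    by (simp add: nn_integral_cmult_indicator)
  moreover have "0 < std_normal_density 2" by (rule normal_density_pos) simp
  ultimately show ?thesis by (simp add: gauss_tail_def ennreal_le_iff)
qed

lemma gauss_tail_le_1: "gauss_tail \<le> 1"
proof -
  interpret prob_space std_normal_distribution by (rule prob_space_N01)
  show ?thesis by (simp add: gauss_tail_def)
qed

text \<open>The expectation equals \<open>1 - (1 - exp (- b)) * gauss_tail\<close>, and
  \<open>1 + x \<le> exp x\<close> puts it in a form suited to a product over \<open>d\<close>
  coordinates.\<close>

lemma nn_integral_tail_damped:
  assumes "0 \<le> b"
  shows "(\<integral>\<^sup>+t. ennreal (if 1 \<le> \<bar>t\<bar> then exp (- b) else 1) \<partial>std_normal_distribution)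
    \<le> ennreal (exp (- (gauss_tail * (1 - exp (- b)))))"
proof -
  interpret prob_space std_normal_distribution by (rule prob_space_N01)
  have eq: "(if 1 \<le> \<bar>t\<bar> then exp (- b) else 1) = 1 - (1 - exp (- b)) * indicator {t. 1 \<le> \<bar>t\<bar>} t" for t :: real
    by (simp add: indicator_def)
  have I: "integrable std_normal_distribution (indicator {t. 1 \<le> \<bar>t\<bar>} :: real \<Rightarrow> real)"
    by (intro integrable_real_indicator) (auto simp: emeasure_eq_measure)
  then have "integrable std_normal_distribution (\<lambda>t. if 1 \<le> \<bar>t\<bar> then exp (- b) else 1)"
    unfolding eq by simp
  then have "(\<integral>\<^sup>+t. ennreal (if 1 \<le> \<bar>t\<bar> then exp (- b) else 1) \<partial>std_normal_distribution)
      = ennreal (\<integral>t. (if 1 \<le> \<bar>t\<bar> then exp (- b) else 1) \<partial>std_normal_distribution)"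
    by (intro nn_integral_eq_integral) auto
  also have "(\<integral>t. (if 1 \<le> \<bar>t\<bar> then exp (- b) else 1) \<partial>std_normal_distribution) = 1 - (1 - exp (- b)) * gauss_tail"
    unfolding eq using I prob_space by (simp add: gauss_tail_def)
  also have "\<dots> \<le> exp (- (gauss_tail * (1 - exp (- b))))"
    using exp_ge_add_one_self[of "- (gauss_tail * (1 - exp (- b)))"] by (simp add: mult.commute)
  finally show ?thesis by (simp add: ennreal_leI)
qed

lemma var_meas_indicator:
  assumes "prob_space \<pi>" and [measurable]: "S \<in> sets \<pi>"
  shows "var_meas \<pi> (indicator S) = measure \<pi> S * (1 - measure \<pi> S)"
proof -
  interpret prob_space \<pi> by fact
  define p where "p = measure \<pi> S"
  have I: "integrable \<pi> (indicator S :: _ \<Rightarrow> real)"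
    by (intro integrable_real_indicator) (auto simp: emeasure_eq_measure)
  have m: "(\<integral>z. indicator S z \<partial>\<pi>) = p"
    using sets.sets_into_space[OF assms(2)] by (simp add: p_def Int_absorb2)
  have eq: "(indicator S x - p)\<^sup>2 = (1 - 2 * p) * indicator S x + p\<^sup>2" for x
    by (simp add: indicator_def power2_eq_square algebra_simps)
  have "var_meas \<pi> (indicator S) = (1 - 2 * p) * p + p\<^sup>2"
    unfolding var_meas_def m eq using I m prob_space by simp
  then show ?thesis by (simp add: p_def power2_eq_square algebra_simps)
qed

context hard_potential begin

text \<open>The minimum of the potential; the restriction makes it extensional, hence a point of
  \<open>Leb d\<close>.\<close>

definition origin :: "nat \<Rightarrow> real" where "origin = (\<lambda>i\<in>{..<d}. 0)"

lemma origin_space: "origin \<in> space (Leb d)"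
  by (simp add: origin_def Leb_def space_PiM)

lemma origin_eq: "i < d \<Longrightarrow> origin i = 0" "i < d \<Longrightarrow> G origin i = 0"
  by (simp_all add: origin_def G_def pot'_def)

text \<open>Symmetric proposals from the minimum of a function with curvature decreasing away from it
  always increase the energy by more than the trapezoidal rule predicts; here the defect is an
  exact expression in \<^term>\<open>sqrt (1 + t\<^sup>2 / h)\<close>.\<close>

lemma trapezoid_defect:
  "pot a h 0 - pot a h t + t * pot' a h t / 2
    = - (a * h * ((sqrt (1 + t\<^sup>2 / h) - 1)\<^sup>2 / (2 * sqrt (1 + t\<^sup>2 / h))))"
proof -
  define u where "u = sqrt (1 + t\<^sup>2 / h)"
  have u: "0 < u" using radicand_pos[of t] by (simp add: u_def)
  have "u\<^sup>2 = 1 + t\<^sup>2 / h" using radicand_pos[of t] by (simp add: u_def)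
  then have t: "t\<^sup>2 = h * (u\<^sup>2 - 1)" using h_pos by simp
  have "pot a h 0 - pot a h t + t * pot' a h t / 2 = a * h * (1 - u) + a * t\<^sup>2 / (2 * u)"
    unfolding pot_def pot'_def u_def[symmetric] using u by (simp add: field_simps power2_eq_square)
  also have "\<dots> = - (a * h * ((u - 1)\<^sup>2 / (2 * u)))"
    unfolding t using u by (simp add: field_simps power2_eq_square)
  finally show ?thesis by (simp add: u_def)
qed

text \<open>At \<open>u = 3 / 2\<close> the defect factor (square of \<open>u - 1\<close>, divided
  by \<open>2 * u\<close>) is exactly 1/12, and it increases with \<open>u\<close>. The hypothesis
  makes the square of \<open>u\<close> at least 3, which exceeds 9/4.\<close>

lemma trapezoid_defect_le:
  assumes "2 * h \<le> t\<^sup>2"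
  shows "pot a h 0 - pot a h t + t * pot' a h t / 2 \<le> - (a * h / 12)"
proof -
  define u where "u = sqrt (1 + t\<^sup>2 / h)"
  have "(3 / 2)\<^sup>2 \<le> 1 + t\<^sup>2 / h"
    using assms h_pos by (simp add: power2_eq_square field_simps)
  then have u: "3 / 2 \<le> u" unfolding u_def by (rule real_le_rsqrt)
  \<comment> \<open>This factorization is the inequality of the next step after clearing
    denominators.\<close>
  then have "0 \<le> (2 * u - 3) * (3 * u - 2)" by simp
  then have "1 / 12 \<le> (u - 1)\<^sup>2 / (2 * u)"
    using u by (simp add: field_simps power2_eq_square)
  then have "a * h * (1 / 12) \<le> a * h * ((u - 1)\<^sup>2 / (2 * u))"
    using a_nonneg h_pos by (intro mult_left_mono) auto
  then show ?thesis by (simp add: trapezoid_defect u_def)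
qed

lemma trapezoid_defect_nonpos: "pot a h 0 - pot a h t + t * pot' a h t / 2 \<le> 0"
  unfolding trapezoid_defect using a_nonneg h_pos radicand_pos[of t] by simp

text \<open>The gradient vanishes at the minimum, so the log acceptance ratio is a sum over
  coordinates. Each summand is a trapezoid defect minus a multiple of a squared derivative; dropping
  the latter leaves the defect bounds.\<close>

lemma accept_origin_le:
  "mala_accept d f G h origin y \<le> (\<Prod>i<d. if 2 * h \<le> (y i)\<^sup>2 then exp (- (a * h / 12)) else 1)"
proof -
  define D where "D i = pot a h 0 - pot a h (y i) + y i * pot' a h (y i) / 2" for i
  have "f origin - f y + (1 / (4 * h)) * ((enorm d (\<lambda>i. y i - origin i + h * G origin i))\<^sup>2
      - (enorm d (\<lambda>i. origin i - y i + h * G y i))\<^sup>2)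
    = (\<Sum>i<d. pot a h 0 - pot a h (y i) + (1 / (4 * h)) * ((y i)\<^sup>2 - (h * pot' a h (y i) - y i)\<^sup>2))"
    unfolding enorm_def f_def
    by (simp add: sum_nonneg origin_eq G_def[of y] add.commute[of _ "h * _"]
        sum.distrib sum_subtractf sum_distrib_left right_diff_distrib)
  also have "\<dots> \<le> (\<Sum>i<d. D i)"
  proof (rule sum_mono)
    fix i
    have "(1 / (4 * h)) * ((y i)\<^sup>2 - (h * pot' a h (y i) - y i)\<^sup>2)
        = y i * pot' a h (y i) / 2 - h * (pot' a h (y i))\<^sup>2 / 4"
      using h_pos by (simp add: field_simps power2_eq_square)
    then show "pot a h 0 - pot a h (y i) + (1 / (4 * h)) * ((y i)\<^sup>2 - (h * pot' a h (y i) - y i)\<^sup>2) \<le> D i"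
      using h_pos by (simp add: D_def)
  qed
  finally have "mala_accept d f G h origin y \<le> exp (\<Sum>i<d. D i)"
    unfolding mala_accept_def by (simp add: min.coboundedI2)
  also have "\<dots> \<le> (\<Prod>i<d. if 2 * h \<le> (y i)\<^sup>2 then exp (- (a * h / 12)) else 1)"
    unfolding exp_sum[OF finite_lessThan] D_def
    using trapezoid_defect_le trapezoid_defect_nonpos by (intro prod_mono) auto
  finally show ?thesis .
qed

lemma proposal_map_measurable [measurable]:
  "(\<lambda>g. \<lambda>i\<in>{..<d}. x i - h * G x i + sqrt (2 * h) * g i) \<in> measurable (Gauss d) (Leb d)"
  unfolding measurable_Gauss unfolding Leb_def by measurable

lemma accept_prob_eq:
  assumes [measurable]: "x \<in> space (Leb d)"
  shows "accept_prob x = (\<integral>\<^sup>+g. ennreal (mala_accept d f G h x (\<lambda>i\<in>{..<d}. x i - h * G x i + sqrt (2 * h) * g i)) \<partial>Gauss d)"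
  unfolding accept_prob_def mala_proposal_def by (subst nn_integral_distr) auto

text \<open>The bound from \<open>accept_origin_le\<close> is a product of functions of independent
  coordinates, so its expectation is a product of one-dimensional expectations.\<close>

lemma accept_prob_origin_le:
  "accept_prob origin \<le> ennreal (exp (- (real d * (gauss_tail * (1 - exp (- (a * h / 12)))))))"
proof -
  define \<rho> :: "real \<Rightarrow> real" where "\<rho> t = (if 1 \<le> \<bar>t\<bar> then exp (- (a * h / 12)) else 1)" for t
  have [measurable]: "\<rho> \<in> borel_measurable borel" unfolding \<rho>_def[abs_def] by measurable
  interpret product_sigma_finite "\<lambda>_::nat. std_normal_distribution"
    by (simp add: product_sigma_finite_def prob_space_imp_sigma_finite prob_space_N01)
  have "mala_accept d f G h origin (\<lambda>i\<in>{..<d}. origin i - h * G origin i + sqrt (2 * h) * g i) \<le> (\<Prod>i<d. \<rho> (g i))" for g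
  proof -
    \<comment> \<open>From the minimum the proposed coordinate is pure noise, so the threshold in
      \<open>y\<close> becomes one in the standard normal variable.\<close>
    have "2 * h \<le> (sqrt (2 * h) * t)\<^sup>2 \<longleftrightarrow> 1 \<le> \<bar>t\<bar>" for t
      using h_pos abs_le_square_iff[of 1 t] by (simp add: power_mult_distrib)
    then show ?thesis
      using accept_origin_le[of "\<lambda>i\<in>{..<d}. origin i - h * G origin i + sqrt (2 * h) * g i"]
      by (simp add: origin_eq \<rho>_def)
  qed
  then have "accept_prob origin \<le> (\<integral>\<^sup>+g. (\<Prod>i<d. ennreal (\<rho> (g i))) \<partial>Gauss d)"
    unfolding accept_prob_eq[OF origin_space]
    by (intro nn_integral_mono) (simp add: prod_ennreal \<rho>_def ennreal_leI)
  also have "\<dots> = (\<Prod>i<d. \<integral>\<^sup>+t. ennreal (\<rho> t) \<partial>std_normal_distribution)"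
    unfolding Gauss_def by (rule product_nn_integral_prod) auto
  also have "\<dots> \<le> (\<Prod>i<d. ennreal (exp (- (gauss_tail * (1 - exp (- (a * h / 12)))))))"
    unfolding \<rho>_def using a_nonneg h_pos by (intro prod_mono_ennreal nn_integral_tail_damped) auto
  also have "\<dots> = ennreal (exp (- (real d * (gauss_tail * (1 - exp (- (a * h / 12)))))))"
    by (simp add: ennreal_power exp_of_nat_mult[symmetric])
  finally show ?thesis .
qed

text \<open>Otherwise some sequence of points tends to the origin with \<open>accept_prob\<close>
  above \<open>\<epsilon>\<close>. Acceptance probabilities are continuous and at most 1, so
  dominated convergence contradicts the strict bound at the origin.\<close>

lemma accept_prob_near_origin:
  assumes "accept_prob origin < \<epsilon>"
  obtains \<delta> where "0 < \<delta>" "\<And>x. x \<in> space (Leb d) \<Longrightarrow> (\<And>i. i < d \<Longrightarrow> \<bar>x i\<bar> < \<delta>) \<Longrightarrow> accept_prob x \<le> \<epsilon>"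
proof -
  have "\<exists>\<delta>>0. \<forall>x\<in>space (Leb d). (\<forall>i<d. \<bar>x i\<bar> < \<delta>) \<longrightarrow> accept_prob x \<le> \<epsilon>"
  proof (rule ccontr)
    assume neg: "\<not> ?thesis"
    have "\<exists>x. x \<in> space (Leb d) \<and> (\<forall>i<d. \<bar>x i\<bar> < inverse (real (Suc n))) \<and> \<epsilon> < accept_prob x" for n
    proof -
      have "0 < inverse (real (Suc n))" by simp
      with neg show ?thesis unfolding not_le[symmetric] by blast
    qed
    then have "\<forall>n. \<exists>x. x \<in> space (Leb d) \<and> (\<forall>i<d. \<bar>x i\<bar> < inverse (real (Suc n))) \<and> \<epsilon> < accept_prob x"
      by blast
    from choice[OF this] obtain X where X: "\<And>n. X n \<in> space (Leb d)"
      "\<And>n i. i < d \<Longrightarrow> \<bar>X n i\<bar> < inverse (real (Suc n))" "\<And>n. \<epsilon> < accept_prob (X n)"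
      by blast
    \<comment> \<open>Driving all starting points by the same noise \<open>g\<close> writes every
      \<open>accept_prob\<close> as an integral over the fixed measure
      \<open>Gauss d\<close>.\<close>
    define Y where "Y x g = (\<lambda>i\<in>{..<d}. x i - h * G x i + sqrt (2 * h) * g i)" for x g
    have Y_meas[measurable]: "Y x \<in> measurable (Gauss d) (Leb d)" for x
      unfolding Y_def[abs_def] by measurable
    have X_lim: "(\<lambda>n. X n i) \<longlonglongrightarrow> origin i" if "i < d" for i
    proof -
      have "(\<lambda>n. X n i) \<longlonglongrightarrow> 0"
      proof (rule Lim_null_comparison)
        show "eventually (\<lambda>n. norm (X n i) \<le> inverse (real (Suc n))) sequentially"
          using X(2)[OF that] by (intro always_eventually allI) (simp add: less_imp_le)
      qed (rule LIMSEQ_inverse_real_of_nat)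
      then show ?thesis using that by (simp add: origin_def)
    qed
    have comp: "(\<lambda>n. F (x n)) \<longlonglongrightarrow> F l" if "continuous_on UNIV F" "x \<longlonglongrightarrow> l" for F :: "real \<Rightarrow> real" and x l
      using that by (simp add: continuous_on_eq_continuous_at isCont_tendsto_compose)
    have G_lim: "(\<lambda>n. G (X n) i) \<longlonglongrightarrow> G origin i" if "i < d" for i
      unfolding G_def by (rule comp[OF continuous_pot' X_lim[OF that]])
    have Y_lim: "(\<lambda>n. Y (X n) g i) \<longlonglongrightarrow> Y origin g i" if "i < d" for g i
    proof -
      have "(\<lambda>n. X n i - h * G (X n) i + sqrt (2 * h) * g i) \<longlonglongrightarrow> origin i - h * G origin i + sqrt (2 * h) * g i"
        by (intro tendsto_intros X_lim G_lim that)
      then show ?thesis using that by (simp add: Y_def)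
    qed
    have GY_lim: "(\<lambda>n. G (Y (X n) g) i) \<longlonglongrightarrow> G (Y origin g) i" if "i < d" for g i
      unfolding G_def by (rule comp[OF continuous_pot' Y_lim[OF that]])
    have lim: "(\<lambda>n. mala_accept d f G h (X n) (Y (X n) g)) \<longlonglongrightarrow> mala_accept d f G h origin (Y origin g)" for g
      unfolding mala_accept_def enorm_def f_def
      by (intro tendsto_min tendsto_exp tendsto_const tendsto_add tendsto_diff tendsto_mult tendsto_power
          tendsto_real_sqrt tendsto_sum comp[OF continuous_pot] X_lim G_lim Y_lim GY_lim) simp_all
    have "(\<lambda>n. \<integral>\<^sup>+g. ennreal (mala_accept d f G h (X n) (Y (X n) g)) \<partial>Gauss d)
        \<longlonglongrightarrow> (\<integral>\<^sup>+g. ennreal (mala_accept d f G h origin (Y origin g)) \<partial>Gauss d)"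
    proof (rule nn_integral_dominated_convergence[where w = "\<lambda>_. 1"])
      show "(\<integral>\<^sup>+g. 1 \<partial>Gauss d) < \<infinity>"
        using prob_space.emeasure_space_1[OF prob_space_Gauss] by simp
      show "(\<lambda>g. ennreal (mala_accept d f G h (X n) (Y (X n) g))) \<in> borel_measurable (Gauss d)" for n
        using X(1)[of n, measurable] by measurable
      show "(\<lambda>g. ennreal (mala_accept d f G h origin (Y origin g))) \<in> borel_measurable (Gauss d)"
        using origin_space[measurable] by measurable
    qed (use lim mala_accept_le_1 in \<open>auto simp: ennreal_le_1\<close>)
    then have "(\<lambda>n. accept_prob (X n)) \<longlonglongrightarrow> accept_prob origin"
      using X(1) origin_space by (simp add: accept_prob_eq Y_def)
    then have "eventually (\<lambda>n. accept_prob (X n) < \<epsilon>) sequentially"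
      using assms by (rule order_tendstoD)
    then show False
      using X(3) by (auto simp: eventually_sequentially dest: less_asym)
  qed
  then show ?thesis using that by blast
qed

text \<open>For a small cube of mass \<open>p\<close>, the Dirichlet form of its indicator is at
  most \<open>\<epsilon> * p\<close> and its variance at least \<open>p / 2\<close>. The mass
  cancels, and the 2 in the bound comes from the variance.\<close>

lemma spectral_gap_le_accept_prob:
  assumes "0 < d" "accept_prob origin < ennreal \<epsilon>" "0 < \<epsilon>"
  shows "spectral_gap (target d f) (mala_kernel d f G h) \<le> ennreal (2 * \<epsilon>)"
proof -
  interpret T: prob_space "target d f" by (rule prob_space_target)
  interpret L: product_sigma_finite "\<lambda>_::nat. lborel :: real measure"
    by (simp add: product_sigma_finite_def sigma_finite_lborel)
  obtain \<delta>0 where \<delta>0: "0 < \<delta>0"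
    "\<And>x. x \<in> space (Leb d) \<Longrightarrow> (\<And>i. i < d \<Longrightarrow> \<bar>x i\<bar> < \<delta>0) \<Longrightarrow> accept_prob x \<le> ennreal \<epsilon>"
    using accept_prob_near_origin[OF assms(2)] by blast
  \<comment> \<open>The bound \<open>\<delta>0\<close> keeps the cube where acceptance is small, 1/2
    makes \<open>(2 * \<delta>) ^ d\<close> at most \<open>2 * \<delta>\<close>, and
    \<open>Z / 4\<close> then makes the mass at most 1/2.\<close>
  define \<delta> where "\<delta> = min \<delta>0 (min (1 / 2) (Z / 4))"
  have \<delta>: "0 < \<delta>" "\<delta> \<le> \<delta>0" "2 * \<delta> \<le> 1" "2 * \<delta> \<le> Z / 2"
    using \<delta>0(1) Z_pos by (auto simp: \<delta>_def min_def)
  define S where "S = (\<Pi>\<^sub>E i\<in>{..<d}. {- \<delta> <..< \<delta>})"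
  have S[measurable]: "S \<in> sets (Leb d)"
    unfolding S_def Leb_def by (intro sets_PiM_I_finite) auto
  then have S': "S \<in> sets (target d f)" by (simp add: target_def)
  have "emeasure (Leb d) S = (\<Prod>i<d. emeasure lborel {- \<delta> <..< \<delta>})"
    unfolding S_def Leb_def by (intro L.emeasure_PiM) auto
  also have "\<dots> = ennreal ((2 * \<delta>) ^ d)"
    using \<delta>(1) by (simp add: ennreal_power)
  finally have vol: "emeasure (Leb d) S = ennreal ((2 * \<delta>) ^ d)" .
  define p where "p = measure (target d f) S"
  have emeasure_p: "emeasure (target d f) S = ennreal p"
    by (simp add: p_def T.emeasure_eq_measure)
  have "emeasure (target d f) S = (\<integral>\<^sup>+x. ennreal (exp (- f x) / Z) * indicator S x \<partial>Leb d)"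
    unfolding target_eq by (subst emeasure_density) auto
  also have "\<dots> \<le> (\<integral>\<^sup>+x. ennreal (1 / Z) * indicator S x \<partial>Leb d)"
    using Z_pos pot_nonneg
    by (intro nn_integral_mono mult_right_mono ennreal_leI divide_right_mono)
       (auto simp: f_def intro!: sum_nonneg)
  also have "\<dots> = ennreal ((2 * \<delta>) ^ d / Z)"
    using Z_pos \<delta>(1) by (simp add: nn_integral_cmult_indicator vol ennreal_mult[symmetric])
  finally have "p \<le> (2 * \<delta>) ^ d / Z"
    using Z_pos \<delta>(1) by (simp add: emeasure_p ennreal_le_iff)
  also have "(2 * \<delta>) ^ d \<le> 2 * \<delta>"
    using power_decreasing[of 1 d "2 * \<delta>"] \<delta> assms(1) by simp
  then have "(2 * \<delta>) ^ d / Z \<le> (2 * \<delta>) / Z"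
    using Z_pos by (intro divide_right_mono) auto
  also have "\<dots> \<le> 1 / 2"
    using \<delta>(4) Z_pos by (simp add: field_simps)
  finally have p_half: "p \<le> 1 / 2" .
  \<comment> \<open>The cube has positive volume and the target density is everywhere
    positive.\<close>
  have "p \<noteq> 0"
  proof
    assume "p = 0"
    then have "S \<in> null_sets (target d f)"
      using S' emeasure_p by (intro null_setsI) auto
    then have "AE x in Leb d. x \<in> S \<longrightarrow> ennreal (exp (- f x) / Z) = 0"
      unfolding target_eq by (subst (asm) null_sets_density_iff) auto
    then have "AE x in Leb d. x \<notin> S"
    proof (rule eventually_mono)
      fix x assume "x \<in> S \<longrightarrow> ennreal (exp (- f x) / Z) = 0"
      moreover have "0 < exp (- f x) / Z" using Z_pos by simp
      ultimately show "x \<notin> S" by (auto simp del: zero_less_divide_iff)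
    qed
    then have "emeasure (Leb d) S = 0"
      using AE_iff_null_sets[OF S] by auto
    then show False using vol \<delta>(1) by simp
  qed
  then have p_pos: "0 < p" by (simp add: p_def zero_less_measure_iff)
  have var: "p / 2 \<le> var_meas (target d f) (indicator S)"
    unfolding var_meas_indicator[OF prob_space_target S'] p_def[symmetric]
    using mult_left_mono[of "1 / 2" "1 - p" p] p_half p_pos by simp
  have "integrable (target d f) (\<lambda>x. (indicator S x :: real)\<^sup>2)"
  proof -
    have "(\<lambda>x. (indicator S x :: real)\<^sup>2) = indicator S"
      by (auto simp: fun_eq_iff indicator_def)
    then show ?thesis
      using S' by (simp add: integrable_real_indicator T.emeasure_eq_measure)
  qed
  then have L2: "indicator S \<in> nonconst_L2 (target d f)"
    using S' var p_pos by (intro nonconst_L2I prob_space_target) auto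
  have "dirichlet_form (target d f) (mala_kernel d f G h) (indicator S)
      \<le> (\<integral>\<^sup>+x. accept_prob x * indicator S x \<partial>target d f)"
    by (rule dirichlet_indicator_le[OF S])
  also have "\<dots> \<le> (\<integral>\<^sup>+x. ennreal \<epsilon> * indicator S x \<partial>target d f)"
  proof (rule nn_integral_mono)
    fix x assume "x \<in> space (target d f)"
    then have x: "x \<in> space (Leb d)" by (simp add: target_def)
    show "accept_prob x * indicator S x \<le> ennreal \<epsilon> * indicator S x"
    proof (cases "x \<in> S")
      case True
      then have "\<bar>x i\<bar> < \<delta>0" if "i < d" for i
        using that \<delta>(2) by (force simp: S_def PiE_def Pi_def)
      then show ?thesis using True \<delta>0(2)[OF x] by simp
    qed simp
  qed
  also have "\<dots> = ennreal (\<epsilon> * p)"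
    using S' assms(3) p_pos by (simp add: nn_integral_cmult_indicator emeasure_p ennreal_mult)
  finally have "dirichlet_form (target d f) (mala_kernel d f G h) (indicator S) \<le> ennreal (\<epsilon> * p)" .
  from spectral_gap_le[OF L2 this var] show ?thesis
    using p_pos assms(3) by (simp add: field_simps)
qed

end

section \<open>Combining the two step size regimes\<close>

lemma hard_potential_witness:
  assumes "hard_potential a h" "1 + a \<le> \<kappa>" "c \<le> 1 / l" "0 < l"
    and "spectral_gap (target d (hard_potential.f d a h))
      (mala_kernel d (hard_potential.f d a h) (hard_potential.G a h) h) \<le> ennreal l"
  shows "\<exists>f G H. has_gradient_on d f G \<and> has_hessian_on d G H
    \<and> (\<forall>x\<in>Rd d. loewner_between d 1 (H x) \<kappa>)
    \<and> integrable (Leb d) (\<lambda>x. exp (- f x))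
    \<and> relaxation_time (target d f) (mala_kernel d f G h) \<ge> ennreal c"
proof -
  interpret hard_potential d a h by fact
  have "ennreal c \<le> ennreal (1 / l)" using assms(3) by (rule ennreal_leI)
  also have "\<dots> \<le> relaxation_time (target d f) (mala_kernel d f G h)"
    using assms(5,4) by (rule relaxation_time_ge)
  finally show ?thesis
    using gradient hessian hessian_bounds[OF assms(2)] integrable_exp_f by blast
qed

theorem theorem2:
  shows "\<exists>c::real. c > 0 \<and> (\<exists>d0::nat. \<forall>d\<ge>d0. \<forall>\<kappa>::real. 10 \<le> \<kappa> \<and> \<kappa> \<le> real d ^ 4 \<longrightarrow>
    (\<forall>h::real. h > 0 \<longrightarrow>
      (\<exists>f G H. has_gradient_on d f G \<and> has_hessian_on d G H
        \<and> (\<forall>x\<in>Rd d. loewner_between d 1 (H x) \<kappa>)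
        \<and> integrable (Leb d) (\<lambda>x. exp (- f x))
        \<and> relaxation_time (target d f) (mala_kernel d f G h)
            \<ge> ennreal (c * \<kappa> * real d / ln (real d)))))"
proof -
  define p where "p = gauss_tail"
  have p: "0 < p" "p \<le> 1" by (simp_all add: p_def gauss_tail_pos gauss_tail_le_1)
  \<comment> \<open>For large \<open>d\<close> this yields \<open>h \<le> 2\<close> in the small
    step regime and \<open>\<tau> \<le> 1\<close> in the other.\<close>
  have "eventually (\<lambda>d::nat. 12 * ln (real d) / real d < p) sequentially"
    using p(1) by (intro order_tendstoD) real_asymp
  then obtain d1 where d1: "\<And>d. d1 \<le> d \<Longrightarrow> 12 * ln (real d) / real d < p"
    by (auto simp: eventually_sequentially)
  show ?thesis
  \<comment> \<open>The constant is fixed by the small steps: the regimes meet at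
    \<open>h = 160 * L / (p * \<kappa> * d)\<close>, where the gap bound \<open>2 * h\<close> gives
    relaxation time \<open>p * \<kappa> * d / (320 * L)\<close>. Taking \<open>d\<close> at least 3
    ensures \<open>1 \<le> ln d\<close>.\<close>
  proof (rule exI[of _ "p / 320"], rule conjI, use p in simp, rule exI[of _ "max 3 d1"], intro allI impI)
    fix d :: nat and \<kappa> h :: real
    assume "max 3 d1 \<le> d" and \<kappa>: "10 \<le> \<kappa> \<and> \<kappa> \<le> real d ^ 4" and h: "0 < h"
    then have d: "3 \<le> d" "12 * ln (real d) < p * real d"
      using d1[of d] by (auto simp: field_simps)
    define L where "L = ln (real d)"
    have "exp 1 \<le> real d" using d(1) exp_le by linarith
    then have L: "1 \<le> L" using d(1) by (simp add: L_def ln_ge_iff)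
    show "\<exists>f G H. has_gradient_on d f G \<and> has_hessian_on d G H
        \<and> (\<forall>x\<in>Rd d. loewner_between d 1 (H x) \<kappa>)
        \<and> integrable (Leb d) (\<lambda>x. exp (- f x))
        \<and> relaxation_time (target d f) (mala_kernel d f G h)
            \<ge> ennreal (p / 320 * \<kappa> * real d / ln (real d))"
    proof (cases "h * (p * \<kappa> * real d) \<le> 160 * L")
      case True
      interpret hard_potential d 0 h using h by unfold_locales auto
      \<comment> \<open>Only \<open>10 \<le> \<kappa>\<close> enters here: it leads to
        \<open>h \<le> 2\<close>, so the quadratic term of the Gaussian gap bound is absorbed into
        \<open>2 * h\<close>.\<close>
      have "h * (p * real d) * 10 \<le> h * (p * real d) * \<kappa>"
        using h p d \<kappa> by (intro mult_left_mono) auto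
      also have "\<dots> \<le> 160 * L" using True by (simp add: mult_ac)
      finally have "h * (p * real d) \<le> 16 * L" by simp
      also have "\<dots> \<le> 2 * (p * real d)" using d(2) L by (simp add: L_def)
      finally have "h \<le> 2" using p d by simp
      then have "h + h\<^sup>2 / 2 \<le> 2 * h" using h by (simp add: power2_eq_square)
      then have "spectral_gap (target d f) (mala_kernel d f G h) \<le> ennreal (2 * h)"
        using d(1) by (intro order.trans[OF spectral_gap_Gauss_le] ennreal_leI) auto
      moreover have "p / 320 * \<kappa> * real d / ln (real d) \<le> 1 / (2 * h)"
        using True h L by (simp add: L_def[symmetric] field_simps)
      ultimately show ?thesis
        using h \<kappa> by (intro hard_potential_witness[OF hard_potential_axioms]) auto
    next
      case False
      interpret hard_potential d "\<kappa> - 1" h using h \<kappa> by unfold_locales auto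
      \<comment> \<open>A lower bound for the damping exponent, chosen so that
        \<open>real d * p * \<tau> / 2\<close> is \<open>6 * L\<close>.\<close>
      define \<tau> where "\<tau> = 12 * L / (p * real d)"
      have \<tau>: "0 \<le> \<tau>" "\<tau> \<le> 1" using d(2) p L by (simp_all add: \<tau>_def L_def field_simps)
      have "\<tau> \<le> (\<kappa> - 1) * h / 12"
      proof -
        have "160 * L \<le> \<kappa> * h * (p * real d)" using False by (simp add: mult_ac)
        then have "160 * L / (p * real d) \<le> \<kappa> * h"
          using p d by (simp add: pos_divide_le_eq)
        then have "160 * L / (p * real d) * (9 / 10) \<le> \<kappa> * h * (9 / 10)" by simp
        \<comment> \<open>As \<open>10 \<le> \<kappa>\<close>, passing to
          \<open>\<kappa> - 1\<close> loses at most a factor 9/10, and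
          \<open>160 * 9 / 10 = 12 * 12\<close>.\<close>
        also have "\<dots> \<le> (\<kappa> - 1) * h" using \<kappa> h by (simp add: field_simps)
        also have "160 * L / (p * real d) * (9 / 10) = 12 * \<tau>" by (simp add: \<tau>_def)
        finally show ?thesis by simp
      qed
      then have "exp (- ((\<kappa> - 1) * h / 12)) \<le> exp (- \<tau>)" by simp
      also have "\<dots> \<le> 1 - \<tau> / 2"
      proof -
        \<comment> \<open>On the unit interval
          \<open>exp (- \<tau>) \<le> 1 / (1 + \<tau>) \<le> 1 - \<tau> / 2\<close>.\<close>
        have "1 \<le> (1 - \<tau> / 2) * (1 + \<tau>)"
          using \<tau> mult_left_mono[of \<tau> 1 \<tau>] by (simp add: algebra_simps)
        also have "\<dots> \<le> (1 - \<tau> / 2) * exp \<tau>"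
          using \<tau> by (intro mult_left_mono exp_ge_add_one_self) auto
        finally show ?thesis by (simp add: exp_minus field_simps)
      qed
      finally have "real d * (p * (\<tau> / 2)) \<le> real d * (p * (1 - exp (- ((\<kappa> - 1) * h / 12))))"
        using p by (intro mult_left_mono) auto
      moreover have "real d * (p * (\<tau> / 2)) = 6 * L"
        using p d by (simp add: \<tau>_def)
      \<comment> \<open>Giving up one of the six multiples of \<open>L\<close> makes the inequality
        strict, as continuity near the origin requires.\<close>
      ultimately have "5 * L < real d * (p * (1 - exp (- ((\<kappa> - 1) * h / 12))))"
        using L by linarith
      then have "exp (- (real d * (p * (1 - exp (- ((\<kappa> - 1) * h / 12)))))) < exp (- (5 * L))"
        by (simp only: exp_less_cancel_iff neg_less_iff_less)
      then have "accept_prob origin < ennreal (exp (- (5 * L)))"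
        using accept_prob_origin_le by (simp add: p_def ennreal_less_iff order.strict_trans1)
      then have gap: "spectral_gap (target d f) (mala_kernel d f G h) \<le> ennreal (2 * exp (- (5 * L)))"
        using d(1) by (intro spectral_gap_le_accept_prob) auto
      have "exp (5 * L) = real d ^ 5"
        using d(1) exp_of_nat_mult[of 5 L] by (simp add: L_def)
      then have e: "1 / (2 * exp (- (5 * L))) = real d ^ 5 / 2"
        by (simp add: exp_minus field_simps)
      have "p / 320 * \<kappa> * real d / ln (real d) \<le> p / 320 * \<kappa> * real d / 1"
        unfolding L_def[symmetric] using L p \<kappa> by (intro divide_left_mono) auto
      \<comment> \<open>The hypothesis \<open>\<kappa> \<le> real d ^ 4\<close> enters here,
        matching the acceptance bound \<open>1 / real d ^ 5\<close>.\<close>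
      also have "\<dots> \<le> 1 / 2 * real d ^ 4 * real d / 1"
        using p \<kappa> by (intro divide_right_mono mult_right_mono mult_mono) auto
      also have "\<dots> = 1 / (2 * exp (- (5 * L)))"
        unfolding e by (simp add: power_Suc2[symmetric])
      finally show ?thesis
        using gap by (intro hard_potential_witness[OF hard_potential_axioms]) auto
    qed
  qed
qed

end
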